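(* The restriction functor $\mathbf{Res}:\widehat{\mathbf{CHaus}}\to\widehat{\beta\mathbf{Sets}}$, $\mathcal F\mapsto \mathcal F|_{\beta\mathbf{Sets}}$, gives an equivalence of categories between $\widehat{\mathbf{CHaus}}_{\star}$ and $\widehat{\beta\mathbf{Sets}}$.
   Context: $\mathbf{Sets}$ denotes a fixed essentially small category of sets such that, if $S$ is in $\mathbf{Sets}$, so is its power set $\mathcal P(S)$ (for example, the category of sets of cardinality strictly smaller than $\kappa$, for $\kappa$ an uncountable strong limit cardinal). $\mathbf{CHaus}$ is the category of compact Hausdorff spaces with underlying set in $\mathbf{Sets}$ and continuous maps. For a set $S$ in $\mathbf{Sets}$, $\beta S$ is the set of ultrafilters on $S$ with its natural compact Hausdorff topology, i.e. the Stone-Čech compactification of the discrete space $S$. $\beta\mathbf{Sets}$ is the full subcategory of $\mathbf{CHaus}$ formed by the objects $\beta S$, for $S$ in $\mathbf{Sets}$. $\widehat{\mathbf{CHaus}}$ and $\widehat{\beta\mathbf{Sets}}$ are the categories of contravariant functors $\mathbf{CHaus}\to\mathbf{Sets}$ and $\beta\mathbf{Sets}\to\mathbf{Sets}$, respectively, with natural transformations as morphisms. $\widehat{\mathbf{CHaus}}_{\star}$ is the full subcategory of $\widehat{\mathbf{CHaus}}$ of those functors $\mathcal F$ such that, for any epimorphism $f:Y\to X$ in $\mathbf{CHaus}$, the natural map $\mathcal F(X)\to \mathrm{eq}\big(\mathcal F(Y)\rightrightarrows\mathcal F(Y\times_X Y)\big)$ (the two arrows being induced by the two projections) is a bijection.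
   Formalization: Sets is assumed closed, up to bijection, under subsets as well as power sets (as for cardinality < κ); with power sets alone the claim fails, e.g. for Sets = infinite sets of cardinality < κ and the presheaf of clopen subsets, whose value at [0,1] would have two elements. *)

theory Defs
  imports "HOL-Analysis.Analysis" "HOL-Library.Equipollence"
begin

section \<open>Categories, functors, natural transformations\<close>

text \<open>
  \<open>Cmp C X Y Z g f\<close> is the composite of \<open>f : X \<rightarrow> Y\<close> and \<open>g : Y \<rightarrow> Z\<close>. All data are indexed by
  objects and are meaningful only on \<open>Ob C\<close> and the sets \<open>Arr C X Y\<close> with \<open>X, Y \<in> Ob C\<close>.
\<close>

record ('o, 'm) category =
  Ob  :: "'o set"
  Arr :: "'o \<Rightarrow> 'o \<Rightarrow> 'm set"
  Ide :: "'o \<Rightarrow> 'm"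
  Cmp :: "'o \<Rightarrow> 'o \<Rightarrow> 'o \<Rightarrow> 'm \<Rightarrow> 'm \<Rightarrow> 'm"

definition is_category :: "('o, 'm) category \<Rightarrow> bool" where
  "is_category C \<longleftrightarrow>
     (\<forall>X\<in>Ob C. Ide C X \<in> Arr C X X) \<and>
     (\<forall>X\<in>Ob C. \<forall>Y\<in>Ob C. \<forall>Z\<in>Ob C. \<forall>f\<in>Arr C X Y. \<forall>g\<in>Arr C Y Z. Cmp C X Y Z g f \<in> Arr C X Z) \<and>
     (\<forall>X\<in>Ob C. \<forall>Y\<in>Ob C. \<forall>f\<in>Arr C X Y.
        Cmp C X X Y f (Ide C X) = f \<and> Cmp C X Y Y (Ide C Y) f = f) \<and>
     (\<forall>W\<in>Ob C. \<forall>X\<in>Ob C. \<forall>Y\<in>Ob C. \<forall>Z\<in>Ob C. \<forall>f\<in>Arr C W X. \<forall>g\<in>Arr C X Y. \<forall>h\<in>Arr C Y Z.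
        Cmp C W Y Z h (Cmp C W X Y g f) = Cmp C W X Z (Cmp C X Y Z h g) f)"

definition op_cat :: "('o, 'm) category \<Rightarrow> ('o, 'm) category" where
  "op_cat C = \<lparr>Ob = Ob C, Arr = (\<lambda>X Y. Arr C Y X), Ide = Ide C,
               Cmp = (\<lambda>X Y Z g f. Cmp C Z Y X f g)\<rparr>"

definition full_subcat :: "('o, 'm) category \<Rightarrow> 'o set \<Rightarrow> ('o, 'm) category" where
  "full_subcat C A = C\<lparr>Ob := A\<rparr>"

definition is_iso :: "('o, 'm) category \<Rightarrow> 'o \<Rightarrow> 'o \<Rightarrow> 'm \<Rightarrow> bool" where
  "is_iso C X Y f \<longleftrightarrow> f \<in> Arr C X Y \<and>
     (\<exists>g\<in>Arr C Y X. Cmp C X Y X g f = Ide C X \<and> Cmp C Y X Y f g = Ide C Y)"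

definition is_epi :: "('o, 'm) category \<Rightarrow> 'o \<Rightarrow> 'o \<Rightarrow> 'm \<Rightarrow> bool" where
  "is_epi C Y X f \<longleftrightarrow> f \<in> Arr C Y X \<and>
     (\<forall>Z\<in>Ob C. \<forall>g\<in>Arr C X Z. \<forall>h\<in>Arr C X Z. Cmp C Y X Z g f = Cmp C Y X Z h f \<longrightarrow> g = h)"

text \<open>\<open>(P, p, q)\<close> is a fibre product \<open>Y \<times>\<^sub>X Y\<close> of \<open>f : Y \<rightarrow> X\<close> with itself.\<close>

definition is_kernel_pair :: "('o, 'm) category \<Rightarrow> 'o \<Rightarrow> 'o \<Rightarrow> 'm \<Rightarrow> 'o \<Rightarrow> 'm \<Rightarrow> 'm \<Rightarrow> bool" where
  "is_kernel_pair C Y X f P p q \<longleftrightarrow>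
     P \<in> Ob C \<and> p \<in> Arr C P Y \<and> q \<in> Arr C P Y \<and> Cmp C P Y X f p = Cmp C P Y X f q \<and>
     (\<forall>T\<in>Ob C. \<forall>a\<in>Arr C T Y. \<forall>b\<in>Arr C T Y. Cmp C T Y X f a = Cmp C T Y X f b \<longrightarrow>
        (\<exists>!u. u \<in> Arr C T P \<and> Cmp C T P Y p u = a \<and> Cmp C T P Y q u = b))"

record ('o, 'm, 'p, 'n) cat_functor =
  Fob :: "'o \<Rightarrow> 'p"
  Fmor :: "'o \<Rightarrow> 'o \<Rightarrow> 'm \<Rightarrow> 'n"

definition is_functor ::
  "('o, 'm) category \<Rightarrow> ('p, 'n) category \<Rightarrow> ('o, 'm, 'p, 'n) cat_functor \<Rightarrow> bool" where
  "is_functor C D F \<longleftrightarrow>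
     (\<forall>X\<in>Ob C. Fob F X \<in> Ob D) \<and>
     (\<forall>X\<in>Ob C. \<forall>Y\<in>Ob C. \<forall>f\<in>Arr C X Y. Fmor F X Y f \<in> Arr D (Fob F X) (Fob F Y)) \<and>
     (\<forall>X\<in>Ob C. Fmor F X X (Ide C X) = Ide D (Fob F X)) \<and>
     (\<forall>X\<in>Ob C. \<forall>Y\<in>Ob C. \<forall>Z\<in>Ob C. \<forall>f\<in>Arr C X Y. \<forall>g\<in>Arr C Y Z.
        Fmor F X Z (Cmp C X Y Z g f) =
        Cmp D (Fob F X) (Fob F Y) (Fob F Z) (Fmor F Y Z g) (Fmor F X Y f))"

definition id_functor :: "('o, 'm, 'o, 'm) cat_functor" where
  "id_functor = \<lparr>Fob = (\<lambda>X. X), Fmor = (\<lambda>X Y f. f)\<rparr>"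

definition comp_functor ::
  "('p, 'n, 'q, 'k) cat_functor \<Rightarrow> ('o, 'm, 'p, 'n) cat_functor \<Rightarrow> ('o, 'm, 'q, 'k) cat_functor" where
  "comp_functor G F =
     \<lparr>Fob = (\<lambda>X. Fob G (Fob F X)),
      Fmor = (\<lambda>X Y f. Fmor G (Fob F X) (Fob F Y) (Fmor F X Y f))\<rparr>"

definition is_nat_trans ::
  "('o, 'm) category \<Rightarrow> ('p, 'n) category \<Rightarrow>
   ('o, 'm, 'p, 'n) cat_functor \<Rightarrow> ('o, 'm, 'p, 'n) cat_functor \<Rightarrow> ('o \<Rightarrow> 'n) \<Rightarrow> bool" where
  "is_nat_trans C D F G \<eta> \<longleftrightarrow>
     (\<forall>X\<in>Ob C. \<eta> X \<in> Arr D (Fob F X) (Fob G X)) \<and>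
     (\<forall>X\<in>Ob C. \<forall>Y\<in>Ob C. \<forall>f\<in>Arr C X Y.
        Cmp D (Fob F X) (Fob F Y) (Fob G Y) (\<eta> Y) (Fmor F X Y f) =
        Cmp D (Fob F X) (Fob G X) (Fob G Y) (Fmor G X Y f) (\<eta> X))"

definition naturally_isomorphic ::
  "('o, 'm) category \<Rightarrow> ('p, 'n) category \<Rightarrow>
   ('o, 'm, 'p, 'n) cat_functor \<Rightarrow> ('o, 'm, 'p, 'n) cat_functor \<Rightarrow> bool" where
  "naturally_isomorphic C D F G \<longleftrightarrow>
     (\<exists>\<eta>. is_nat_trans C D F G \<eta> \<and> (\<forall>X\<in>Ob C. is_iso D (Fob F X) (Fob G X) (\<eta> X)))"

definition is_equivalence ::
  "('o, 'm) category \<Rightarrow> ('p, 'n) category \<Rightarrow> ('o, 'm, 'p, 'n) cat_functor \<Rightarrow> bool" where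
  "is_equivalence C D F \<longleftrightarrow>
     is_category C \<and> is_category D \<and> is_functor C D F \<and>
     (\<exists>G. is_functor D C G \<and>
          naturally_isomorphic C C id_functor (comp_functor G F) \<and>
          naturally_isomorphic D D (comp_functor F G) id_functor)"

text \<open>
  \<open>restrict_functor C F\<close> keeps the values of \<open>F\<close> on objects and arrows of \<open>C\<close> and sets all others to
  \<^const>\<open>undefined\<close>. It is used both to restrict functors to a subcategory and to single out one
  HOL representative of each functor on \<open>C\<close>, so that equality of objects of the functor category is
  equality of functors; natural transformations are made extensional for the same reason.
\<close>

definition restrict_functor ::
  "('o, 'm) category \<Rightarrow> ('o, 'm, 'p, 'n) cat_functor \<Rightarrow> ('o, 'm, 'p, 'n) cat_functor" where
  "restrict_functor C F =
     \<lparr>Fob = restrict (Fob F) (Ob C),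
      Fmor = (\<lambda>X Y f. if X \<in> Ob C \<and> Y \<in> Ob C \<and> f \<in> Arr C X Y then Fmor F X Y f else undefined)\<rparr>"

definition functor_cat ::
  "('o, 'm) category \<Rightarrow> ('p, 'n) category \<Rightarrow> (('o, 'm, 'p, 'n) cat_functor, 'o \<Rightarrow> 'n) category" where
  "functor_cat C D =
     \<lparr>Ob = {F. is_functor C D F \<and> restrict_functor C F = F},
      Arr = (\<lambda>F G. {\<eta> \<in> extensional (Ob C). is_nat_trans C D F G \<eta>}),
      Ide = (\<lambda>F. \<lambda>X\<in>Ob C. Ide D (Fob F X)),
      Cmp = (\<lambda>F G H \<theta> \<eta>. \<lambda>X\<in>Ob C. Cmp D (Fob F X) (Fob G X) (Fob H X) (\<theta> X) (\<eta> X))\<rparr>"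


section \<open>The categories of sets and of compact Hausdorff spaces\<close>

text \<open>
  The essentially small category of sets is given by a collection \<open>\<U>\<close> of subsets of a type \<open>'u\<close>,
  which contains, up to bijection, the power set of each of its members and all subsets of that
  power set (hence also all subsets and binary products of members). Up to bijection, because
  \<open>Pow S\<close> does not live in the same type as \<open>S\<close>.
\<close>

definition set_universe :: "'u set set \<Rightarrow> bool" where
  "set_universe \<U> \<longleftrightarrow> (\<forall>S\<in>\<U>. \<forall>A \<subseteq> Pow S. \<exists>T\<in>\<U>. T \<approx> A)"

definition Sets_cat :: "'u set set \<Rightarrow> ('u set, 'u \<Rightarrow> 'u) category" where
  "Sets_cat \<U> = \<lparr>Ob = \<U>, Arr = (\<lambda>A B. A \<rightarrow>\<^sub>E B), Ide = (\<lambda>A. \<lambda>x\<in>A. x),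
                 Cmp = (\<lambda>A B C g f. compose A g f)\<rparr>"

definition CHaus :: "'u set set \<Rightarrow> ('u topology, 'u \<Rightarrow> 'u) category" where
  "CHaus \<U> =
     \<lparr>Ob = {X. compact_space X \<and> Hausdorff_space X \<and> topspace X \<in> \<U>},
      Arr = (\<lambda>X Y. {f \<in> extensional (topspace X). continuous_map X Y f}),
      Ide = (\<lambda>X. \<lambda>x\<in>topspace X. x),
      Cmp = (\<lambda>X Y Z g f. compose (topspace X) g f)\<rparr>"

definition ultrafilters_on :: "'a set \<Rightarrow> 'a set set set" where
  "ultrafilters_on S = {F. F \<subseteq> Pow S \<and> S \<in> F \<and> {} \<notin> F \<and>
     (\<forall>A\<in>F. \<forall>B\<in>F. A \<inter> B \<in> F) \<and>
     (\<forall>A\<in>F. \<forall>B. A \<subseteq> B \<and> B \<subseteq> S \<longrightarrow> B \<in> F) \<and>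
     (\<forall>A. A \<subseteq> S \<longrightarrow> A \<in> F \<or> S - A \<in> F)}"

definition ultrafilter_space :: "'a set \<Rightarrow> 'a set set topology" where
  "ultrafilter_space S = topology_generated_by ((\<lambda>A. {F \<in> ultrafilters_on S. A \<in> F}) ` Pow S)"

text \<open>
  A chosen homeomorphic copy of \<open>\<beta>S\<close> with underlying set in \<open>\<U>\<close>; it exists by \<open>beta_copy\<close> below.
\<close>

definition beta :: "'u set set \<Rightarrow> 'u set \<Rightarrow> 'u topology" where
  "beta \<U> S = (SOME X. topspace X \<in> \<U> \<and> X homeomorphic_space ultrafilter_space S)"

definition beta_Sets :: "'u set set \<Rightarrow> ('u topology, 'u \<Rightarrow> 'u) category" where
  "beta_Sets \<U> = full_subcat (CHaus \<U>) (beta \<U> ` \<U>)"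

lemma topspace_ultrafilter_space: "topspace (ultrafilter_space S) = ultrafilters_on S"
  by (auto simp: ultrafilter_space_def ultrafilters_on_def topology_generated_by_topspace)

lemma homeomorphic_copy:
  assumes "bij_betw g T (topspace Y)"
  shows "\<exists>X. topspace X = T \<and> X homeomorphic_space Y"
proof -
  let ?X = "pullback_topology T g Y"
  let ?h = "inv_into T g"
  have top: "topspace ?X = T"
    using assms by (auto simp: topspace_pullback_topology bij_betw_def)
  have "continuous_map ?X Y g"
    using assms continuous_map_pullback[of Y Y id T g] by simp
  moreover have "continuous_map Y ?X ?h"
  proof (rule continuous_map_pullback')
    show "continuous_map Y Y (g \<circ> ?h)"
      by (rule continuous_map_eq[of _ _ id])
         (use assms in \<open>auto simp: bij_betw_inv_into_right\<close>)
    show "topspace Y \<subseteq> ?h -` T"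
      using assms by (auto simp: bij_betw_def inv_into_into)
  qed
  ultimately have "homeomorphic_maps ?X Y g ?h"
    using assms by (auto simp: homeomorphic_maps_def top bij_betw_inv_into_left bij_betw_inv_into_right)
  then show ?thesis
    using top unfolding homeomorphic_space_def by blast
qed

lemma beta_copy:
  assumes U: "set_universe \<U>" and S: "S \<in> \<U>"
  shows "topspace (beta \<U> S) \<in> \<U> \<and> beta \<U> S homeomorphic_space ultrafilter_space S"
proof -
  obtain P where P: "P \<in> \<U>" "P \<approx> Pow S"
    using U S unfolding set_universe_def by blast
  then obtain f where f: "bij_betw f (Pow S) P"
    using eqpoll_sym unfolding eqpoll_def by blast
  have sub: "(`) f ` ultrafilters_on S \<subseteq> Pow P"
    using f by (auto simp: ultrafilters_on_def bij_betw_def)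
  have "inj_on ((`) f) (ultrafilters_on S)"
    by (rule inj_on_subset[of _ "Pow (Pow S)"])
       (use f in \<open>auto simp: ultrafilters_on_def bij_betw_def intro: inj_on_image_Pow\<close>)
  then have "ultrafilters_on S \<approx> (`) f ` ultrafilters_on S"
    by (metis eqpoll_sym inj_on_image_eqpoll_self)
  moreover obtain T where T: "T \<in> \<U>" "T \<approx> (`) f ` ultrafilters_on S"
    using U P(1) sub unfolding set_universe_def by blast
  ultimately obtain g where "bij_betw g T (topspace (ultrafilter_space S))"
    unfolding topspace_ultrafilter_space using eqpoll_def eqpoll_sym eqpoll_trans by blast
  then have "\<exists>X. topspace X \<in> \<U> \<and> X homeomorphic_space ultrafilter_space S"
    using homeomorphic_copy T(1) by metis
  then show ?thesis
    unfolding beta_def by (rule someI_ex)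
qed


section \<open>Presheaves and the restriction functor\<close>

type_synonym 'u presheaf = "('u topology, 'u \<Rightarrow> 'u, 'u set, 'u \<Rightarrow> 'u) cat_functor"

definition CHaus_hat :: "'u set set \<Rightarrow> ('u presheaf, 'u topology \<Rightarrow> 'u \<Rightarrow> 'u) category" where
  "CHaus_hat \<U> = functor_cat (op_cat (CHaus \<U>)) (Sets_cat \<U>)"

definition beta_Sets_hat :: "'u set set \<Rightarrow> ('u presheaf, 'u topology \<Rightarrow> 'u \<Rightarrow> 'u) category" where
  "beta_Sets_hat \<U> = functor_cat (op_cat (beta_Sets \<U>)) (Sets_cat \<U>)"

text \<open>
  As \<open>F\<close> is a functor on the opposite category, \<open>Fmor F X Y f : F(X) \<rightarrow> F(Y)\<close> for \<open>f : Y \<rightarrow> X\<close>.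
\<close>

definition CHaus_hat_star :: "'u set set \<Rightarrow> ('u presheaf, 'u topology \<Rightarrow> 'u \<Rightarrow> 'u) category" where
  "CHaus_hat_star \<U> = full_subcat (CHaus_hat \<U>)
     {F \<in> Ob (CHaus_hat \<U>).
        \<forall>X\<in>Ob (CHaus \<U>). \<forall>Y\<in>Ob (CHaus \<U>). \<forall>f. is_epi (CHaus \<U>) Y X f \<longrightarrow>
          (\<forall>P p q. is_kernel_pair (CHaus \<U>) Y X f P p q \<longrightarrow>
             bij_betw (Fmor F X Y f) (Fob F X)
               {y \<in> Fob F Y. Fmor F Y P p y = Fmor F Y P q y})}"

definition Res ::
  "'u set set \<Rightarrow> ('u presheaf, 'u topology \<Rightarrow> 'u \<Rightarrow> 'u, 'u presheaf, 'u topology \<Rightarrow> 'u \<Rightarrow> 'u) cat_functor" where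
  "Res \<U> = \<lparr>Fob = restrict_functor (op_cat (beta_Sets \<U>)),
            Fmor = (\<lambda>F G \<eta>. restrict \<eta> (Ob (beta_Sets \<U>)))\<rparr>"

end

theory Submission
  imports Defs
begin

text \<open>
  Every compact Hausdorff space \<open>X\<close> is covered by \<open>\<beta>|X|\<close>, and the spaces \<open>\<beta>S\<close> are projective with
  respect to epimorphisms. Only these two facts and the existence of kernel pairs matter. A functor \<open>F\<close>
  with descent satisfies \<open>F(X) = {y \<in> F(\<beta>|X|). a\<^sup>* y = a'\<^sup>* y for all a, a' : \<beta>S \<rightarrow> \<beta>|X| equalised by
  \<beta>|X| \<rightarrow> X}\<close>, because the kernel pair of \<open>\<beta>|X| \<rightarrow> X\<close> is itself covered by some \<open>\<beta>S\<close>; so natural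
  transformations into \<open>F\<close> are determined by their restrictions to \<open>\<beta>Sets\<close> and can be extended from
  there. Conversely, for a functor \<open>G\<close> on \<open>\<beta>Sets\<close> the right-hand side with \<open>G\<close> in place of \<open>F\<close>
  defines an extension of \<open>G\<close> to all compact Hausdorff spaces: a map \<open>Y \<rightarrow> X\<close> acts through any lift
  \<open>\<beta>|Y| \<rightarrow> \<beta>|X|\<close>, and the compatibility condition makes the choice irrelevant. Descent along an
  epimorphism \<open>Y \<rightarrow> X\<close> follows from a lift of \<open>\<beta>|X| \<rightarrow> X\<close> to \<open>\<beta>|X| \<rightarrow> \<beta>|Y|\<close>.
\<close>


section \<open>Functor categories and equivalences\<close>

lemma Ide_in_Arr:
  "is_category C \<Longrightarrow> X \<in> Ob C \<Longrightarrow> Ide C X \<in> Arr C X X"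
  by (simp add: is_category_def)

lemma Cmp_in_Arr:
  "is_category C \<Longrightarrow> X \<in> Ob C \<Longrightarrow> Y \<in> Ob C \<Longrightarrow> Z \<in> Ob C \<Longrightarrow> f \<in> Arr C X Y \<Longrightarrow> g \<in> Arr C Y Z \<Longrightarrow>
   Cmp C X Y Z g f \<in> Arr C X Z"
  by (simp add: is_category_def)

lemma Cmp_Ide_right:
  "is_category C \<Longrightarrow> X \<in> Ob C \<Longrightarrow> Y \<in> Ob C \<Longrightarrow> f \<in> Arr C X Y \<Longrightarrow> Cmp C X X Y f (Ide C X) = f"
  by (simp add: is_category_def)

lemma Cmp_Ide_left:
  "is_category C \<Longrightarrow> X \<in> Ob C \<Longrightarrow> Y \<in> Ob C \<Longrightarrow> f \<in> Arr C X Y \<Longrightarrow> Cmp C X Y Y (Ide C Y) f = f"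
  by (simp add: is_category_def)

lemma Cmp_assoc:
  "is_category C \<Longrightarrow> W \<in> Ob C \<Longrightarrow> X \<in> Ob C \<Longrightarrow> Y \<in> Ob C \<Longrightarrow> Z \<in> Ob C \<Longrightarrow>
   f \<in> Arr C W X \<Longrightarrow> g \<in> Arr C X Y \<Longrightarrow> h \<in> Arr C Y Z \<Longrightarrow>
   Cmp C W X Z (Cmp C X Y Z h g) f = Cmp C W Y Z h (Cmp C W X Y g f)"
  by (simp add: is_category_def)

lemma op_cat_simps [simp]:
  "Ob (op_cat C) = Ob C" "Arr (op_cat C) X Y = Arr C Y X" "Ide (op_cat C) = Ide C"
  "Cmp (op_cat C) X Y Z g f = Cmp C Z Y X f g"
  by (simp_all add: op_cat_def)

lemma full_subcat_simps [simp]: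
  "Ob (full_subcat C A) = A" "Arr (full_subcat C A) = Arr C" "Ide (full_subcat C A) = Ide C"
  "Cmp (full_subcat C A) = Cmp C"
  by (simp_all add: full_subcat_def)

lemma Sets_cat_simps [simp]:
  "Ob (Sets_cat \<U>) = \<U>" "Arr (Sets_cat \<U>) A B = A \<rightarrow>\<^sub>E B" "Ide (Sets_cat \<U>) A = (\<lambda>x\<in>A. x)"
  "Cmp (Sets_cat \<U>) A B D g f = compose A g f"
  by (simp_all add: Sets_cat_def)

lemma functor_cat_simps [simp]:
  "Ob (functor_cat C D) = {F. is_functor C D F \<and> restrict_functor C F = F}"
  "Arr (functor_cat C D) F G = {\<eta> \<in> extensional (Ob C). is_nat_trans C D F G \<eta>}"
  "Ide (functor_cat C D) F = (\<lambda>X\<in>Ob C. Ide D (Fob F X))"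
  "Cmp (functor_cat C D) F G H \<theta> \<eta> = (\<lambda>X\<in>Ob C. Cmp D (Fob F X) (Fob G X) (Fob H X) (\<theta> X) (\<eta> X))"
  by (simp_all add: functor_cat_def)

lemma is_category_full_subcat: "is_category C \<Longrightarrow> A \<subseteq> Ob C \<Longrightarrow> is_category (full_subcat C A)"
  unfolding is_category_def full_subcat_simps by (meson subsetD)

lemma is_category_Sets_cat: "is_category (Sets_cat \<U>)"
  unfolding is_category_def Sets_cat_simps
proof (intro conjI ballI)
  fix X Y :: "'a set" and f assume "f \<in> X \<rightarrow>\<^sub>E Y"
  then show "compose X f (\<lambda>x\<in>X. x) = f" "compose X (\<lambda>x\<in>Y. x) f = f"
    by (fastforce simp: compose_def PiE_iff extensional_def)+
next
  fix W X Y Z :: "'a set" and f g h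
  assume "f \<in> W \<rightarrow>\<^sub>E X" "g \<in> X \<rightarrow>\<^sub>E Y" "h \<in> Y \<rightarrow>\<^sub>E Z"
  then show "compose W h (compose W g f) = compose W (compose X h g) f"
    by (fastforce simp: compose_def PiE_iff)
qed (auto simp: compose_def PiE_iff)

section \<open>Functors, natural transformations and the functor category\<close>

lemma is_functor_Fob: "is_functor C D F \<Longrightarrow> X \<in> Ob C \<Longrightarrow> Fob F X \<in> Ob D"
  by (simp add: is_functor_def)

lemma is_functor_Fmor:
  "is_functor C D F \<Longrightarrow> X \<in> Ob C \<Longrightarrow> Y \<in> Ob C \<Longrightarrow> f \<in> Arr C X Y \<Longrightarrow>
   Fmor F X Y f \<in> Arr D (Fob F X) (Fob F Y)"
  by (simp add: is_functor_def)

lemma is_functor_Ide: "is_functor C D F \<Longrightarrow> X \<in> Ob C \<Longrightarrow> Fmor F X X (Ide C X) = Ide D (Fob F X)"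
  by (simp add: is_functor_def)

lemma is_functor_Cmp:
  "is_functor C D F \<Longrightarrow> X \<in> Ob C \<Longrightarrow> Y \<in> Ob C \<Longrightarrow> Z \<in> Ob C \<Longrightarrow> f \<in> Arr C X Y \<Longrightarrow> g \<in> Arr C Y Z \<Longrightarrow>
   Fmor F X Z (Cmp C X Y Z g f) =
     Cmp D (Fob F X) (Fob F Y) (Fob F Z) (Fmor F Y Z g) (Fmor F X Y f)"
  by (simp add: is_functor_def)

lemma nat_trans_Arr: "is_nat_trans C D F G \<eta> \<Longrightarrow> X \<in> Ob C \<Longrightarrow> \<eta> X \<in> Arr D (Fob F X) (Fob G X)"
  by (simp add: is_nat_trans_def)

lemma nat_trans_comm:
  "is_nat_trans C D F G \<eta> \<Longrightarrow> X \<in> Ob C \<Longrightarrow> Y \<in> Ob C \<Longrightarrow> f \<in> Arr C X Y \<Longrightarrow>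
   Cmp D (Fob F X) (Fob F Y) (Fob G Y) (\<eta> Y) (Fmor F X Y f) =
   Cmp D (Fob F X) (Fob G X) (Fob G Y) (Fmor G X Y f) (\<eta> X)"
  by (simp add: is_nat_trans_def)

lemma nat_trans_Ide:
  assumes "is_category D" "is_functor C D F"
  shows "is_nat_trans C D F F (\<lambda>X\<in>Ob C. Ide D (Fob F X))"
  using assms
  by (simp add: is_nat_trans_def Ide_in_Arr Cmp_Ide_left Cmp_Ide_right is_functor_Fob is_functor_Fmor)

text \<open>The two naturality squares are pasted together; associativity in \<open>D\<close> moves
  the brackets between the two uses.\<close>

lemma nat_trans_Cmp:
  assumes D: "is_category D" and F: "is_functor C D F" and G: "is_functor C D G"
    and H: "is_functor C D H" and \<eta>: "is_nat_trans C D F G \<eta>" and \<theta>: "is_nat_trans C D G H \<theta>"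
  shows "is_nat_trans C D F H (\<lambda>X\<in>Ob C. Cmp D (Fob F X) (Fob G X) (Fob H X) (\<theta> X) (\<eta> X))"
  unfolding is_nat_trans_def
proof (intro conjI ballI)
  fix X assume "X \<in> Ob C"
  then show "(\<lambda>X\<in>Ob C. Cmp D (Fob F X) (Fob G X) (Fob H X) (\<theta> X) (\<eta> X)) X
      \<in> Arr D (Fob F X) (Fob H X)"
    using assms by (simp add: Cmp_in_Arr is_functor_Fob nat_trans_Arr)
next
  fix X Y f assume X: "X \<in> Ob C" and Y: "Y \<in> Ob C" and f: "f \<in> Arr C X Y"
  note ob = X Y is_functor_Fob[OF F X] is_functor_Fob[OF F Y] is_functor_Fob[OF G X]
    is_functor_Fob[OF G Y] is_functor_Fob[OF H X] is_functor_Fob[OF H Y]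
  note ar = is_functor_Fmor[OF F X Y f] is_functor_Fmor[OF G X Y f] is_functor_Fmor[OF H X Y f]
    nat_trans_Arr[OF \<eta> X] nat_trans_Arr[OF \<eta> Y] nat_trans_Arr[OF \<theta> X] nat_trans_Arr[OF \<theta> Y]
  have "Cmp D (Fob F X) (Fob F Y) (Fob H Y) (Cmp D (Fob F Y) (Fob G Y) (Fob H Y) (\<theta> Y) (\<eta> Y)) (Fmor F X Y f)
    = Cmp D (Fob F X) (Fob G Y) (Fob H Y) (\<theta> Y) (Cmp D (Fob F X) (Fob G X) (Fob G Y) (Fmor G X Y f) (\<eta> X))"
    using nat_trans_comm[OF \<eta> X Y f] by (simp add: Cmp_assoc[OF D] ob ar)
  also have "\<dots> = Cmp D (Fob F X) (Fob G X) (Fob H Y)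
      (Cmp D (Fob G X) (Fob H X) (Fob H Y) (Fmor H X Y f) (\<theta> X)) (\<eta> X)"
    using nat_trans_comm[OF \<theta> X Y f] by (simp add: Cmp_assoc[OF D, symmetric] ob ar)
  also have "\<dots> = Cmp D (Fob F X) (Fob H X) (Fob H Y) (Fmor H X Y f)
      (Cmp D (Fob F X) (Fob G X) (Fob H X) (\<theta> X) (\<eta> X))"
    by (simp add: Cmp_assoc[OF D] ob ar)
  finally show "Cmp D (Fob F X) (Fob F Y) (Fob H Y)
      ((\<lambda>X\<in>Ob C. Cmp D (Fob F X) (Fob G X) (Fob H X) (\<theta> X) (\<eta> X)) Y) (Fmor F X Y f) =
    Cmp D (Fob F X) (Fob H X) (Fob H Y) (Fmor H X Y f)
      ((\<lambda>X\<in>Ob C. Cmp D (Fob F X) (Fob G X) (Fob H X) (\<theta> X) (\<eta> X)) X)"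
    using X Y by simp
qed

lemma is_category_functor_cat:
  assumes D: "is_category D"
  shows "is_category (functor_cat C D)"
  unfolding is_category_def
proof (intro conjI ballI)
  fix F assume "F \<in> Ob (functor_cat C D)"
  then show "Ide (functor_cat C D) F \<in> Arr (functor_cat C D) F F"
    by (simp add: nat_trans_Ide D)
next
  fix F G H \<eta> \<theta>
  assume "F \<in> Ob (functor_cat C D)" "G \<in> Ob (functor_cat C D)" "H \<in> Ob (functor_cat C D)"
    "\<eta> \<in> Arr (functor_cat C D) F G" "\<theta> \<in> Arr (functor_cat C D) G H"
  then show "Cmp (functor_cat C D) F G H \<theta> \<eta> \<in> Arr (functor_cat C D) F H"
    by (simp add: nat_trans_Cmp D)
next
  fix F G \<eta>
  assume "F \<in> Ob (functor_cat C D)" "G \<in> Ob (functor_cat C D)" "\<eta> \<in> Arr (functor_cat C D) F G"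
  \<comment> \<open>Off \<open>Ob C\<close> both sides are \<open>undefined\<close> because \<eta>
    is extensional; this makes the unit laws strict equalities.\<close>
  then show "Cmp (functor_cat C D) F F G \<eta> (Ide (functor_cat C D) F) = \<eta>"
    "Cmp (functor_cat C D) F G G (Ide (functor_cat C D) G) \<eta> = \<eta>"
    by (auto simp: fun_eq_iff extensional_def Cmp_Ide_left[OF D] Cmp_Ide_right[OF D] is_functor_Fob nat_trans_Arr)
next
  fix F G H K \<eta> \<theta> \<kappa>
  assume "F \<in> Ob (functor_cat C D)" "G \<in> Ob (functor_cat C D)" "H \<in> Ob (functor_cat C D)"
    "K \<in> Ob (functor_cat C D)" "\<eta> \<in> Arr (functor_cat C D) F G" "\<theta> \<in> Arr (functor_cat C D) G H"
    "\<kappa> \<in> Arr (functor_cat C D) H K"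
  then show "Cmp (functor_cat C D) F H K \<kappa> (Cmp (functor_cat C D) F G H \<theta> \<eta>) =
    Cmp (functor_cat C D) F G K (Cmp (functor_cat C D) G H K \<kappa> \<theta>) \<eta>"
    by (auto simp: fun_eq_iff Cmp_assoc[OF D] is_functor_Fob nat_trans_Arr)
qed

text \<open>A quasi-inverse is built by choice: pick for every object of \<open>D\<close> an
  isomorphic value of \<open>F\<close>, conjugate arrows of \<open>D\<close> by the chosen
  isomorphisms, and pull them back through the bijections on hom-sets. Equations in \<open>C\<close>
  are verified after applying \<open>F\<close>, which reflects them.\<close>

lemma is_equivalenceI:
  fixes F :: "('o, 'm, 'p, 'n) cat_functor"
  assumes C: "is_category C" and D: "is_category D" and F: "is_functor C D F"
    and ff: "\<And>X Y. X \<in> Ob C \<Longrightarrow> Y \<in> Ob C \<Longrightarrow>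
      bij_betw (Fmor F X Y) (Arr C X Y) (Arr D (Fob F X) (Fob F Y))"
    and es: "\<And>A. A \<in> Ob D \<Longrightarrow> \<exists>X\<in>Ob C. \<exists>e. is_iso D (Fob F X) A e"
  shows "is_equivalence C D F"
proof -
  define R where "R A = (SOME X. X \<in> Ob C \<and> (\<exists>e. is_iso D (Fob F X) A e))" for A
  have R: "R A \<in> Ob C" "\<exists>e. is_iso D (Fob F (R A)) A e" if "A \<in> Ob D" for A
    using es[OF that] someI_ex[of "\<lambda>X. X \<in> Ob C \<and> (\<exists>e. is_iso D (Fob F X) A e)"]
    unfolding R_def by blast+
  define e where "e A = (SOME e. is_iso D (Fob F (R A)) A e)" for A
  have e: "is_iso D (Fob F (R A)) A (e A)" if "A \<in> Ob D" for A
    unfolding e_def using R(2)[OF that] by (rule someI_ex)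
  define d where "d A = (SOME d. d \<in> Arr D A (Fob F (R A)) \<and>
      Cmp D (Fob F (R A)) A (Fob F (R A)) d (e A) = Ide D (Fob F (R A)) \<and>
      Cmp D A (Fob F (R A)) A (e A) d = Ide D A)" for A
  have d0: "d A \<in> Arr D A (Fob F (R A)) \<and>
      Cmp D (Fob F (R A)) A (Fob F (R A)) (d A) (e A) = Ide D (Fob F (R A)) \<and>
      Cmp D A (Fob F (R A)) A (e A) (d A) = Ide D A" if "A \<in> Ob D" for A
    unfolding d_def by (rule someI_ex) (use e[OF that] in \<open>auto simp: is_iso_def\<close>)
  note Fob = is_functor_Fob[OF F]
  note FR = Fob[OF R(1)]
  have eA: "e A \<in> Arr D (Fob F (R A)) A" if "A \<in> Ob D" for A
    using e[OF that] by (simp add: is_iso_def)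
  have dA: "d A \<in> Arr D A (Fob F (R A))" if "A \<in> Ob D" for A
    using d0[OF that] by simp
  have de: "Cmp D (Fob F (R A)) A (Fob F (R A)) (d A) (e A) = Ide D (Fob F (R A))" if "A \<in> Ob D" for A
    using d0[OF that] by simp
  have ed: "Cmp D A (Fob F (R A)) A (e A) (d A) = Ide D A" if "A \<in> Ob D" for A
    using d0[OF that] by simp
  have de': "Cmp D X A (Fob F (R A)) (d A) (Cmp D X (Fob F (R A)) A (e A) f) = f"
    if "A \<in> Ob D" "X \<in> Ob D" "f \<in> Arr D X (Fob F (R A))" for A X f
    using that by (simp add: Cmp_assoc[OF D, symmetric] FR eA dA de Cmp_Ide_left[OF D])
  have ed': "Cmp D X (Fob F (R A)) A (e A) (Cmp D X A (Fob F (R A)) (d A) f) = f"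
    if "A \<in> Ob D" "X \<in> Ob D" "f \<in> Arr D X A" for A X f
    using that by (simp add: Cmp_assoc[OF D, symmetric] FR eA dA ed Cmp_Ide_left[OF D])
  define I where "I X Y = inv_into (Arr C X Y) (Fmor F X Y)" for X Y
  have I: "I X Y h \<in> Arr C X Y" "Fmor F X Y (I X Y h) = h"
    if "X \<in> Ob C" "Y \<in> Ob C" "h \<in> Arr D (Fob F X) (Fob F Y)" for X Y h
    using ff[OF that(1,2)] that(3) unfolding I_def
    by (auto simp: bij_betw_def inv_into_into f_inv_into_f)
  have Fmor_inj: "f = g" if "X \<in> Ob C" "Y \<in> Ob C" "f \<in> Arr C X Y" "g \<in> Arr C X Y"
    "Fmor F X Y f = Fmor F X Y g" for X Y f g
    using ff[OF that(1,2)] that(3-) by (auto simp: bij_betw_def inj_on_def)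
  \<comment> \<open>Conjugation by the chosen isomorphisms turns an arrow from \<open>A\<close> to
    \<open>B\<close> into one from \<open>Fob F (R A)\<close> to \<open>Fob F (R B)\<close>, to
    which \<open>I\<close> applies.\<close>
  define t where "t A B h = Cmp D (Fob F (R A)) B (Fob F (R B)) (d B) (Cmp D (Fob F (R A)) A B h (e A))"
    for A B h
  have t: "t A B h \<in> Arr D (Fob F (R A)) (Fob F (R B))"
    if "A \<in> Ob D" "B \<in> Ob D" "h \<in> Arr D A B" for A B h
    unfolding t_def using that by (intro Cmp_in_Arr[OF D] FR eA dA) auto
  define G where "G = \<lparr>Fob = R, Fmor = (\<lambda>A B h. I (R A) (R B) (t A B h))\<rparr>"
  have G_simps [simp]: "Fob G = R" "Fmor G A B h = I (R A) (R B) (t A B h)" for A B h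
    by (simp_all add: G_def)
  have "is_functor D C G"
    unfolding is_functor_def
  proof (intro conjI ballI)
    fix A assume A: "A \<in> Ob D"
    then show "Fmor G A A (Ide D A) = Ide C (Fob G A)"
      by (intro Fmor_inj[of "R A" "R A"])
        (simp_all add: R I t Ide_in_Arr[OF C] Ide_in_Arr[OF D] is_functor_Ide[OF F] t_def
          Cmp_Ide_left[OF D] FR eA de)
  next
    fix A B K f g assume ABK: "A \<in> Ob D" "B \<in> Ob D" "K \<in> Ob D" and fg: "f \<in> Arr D A B" "g \<in> Arr D B K"
    have "t A K (Cmp D A B K g f) = Cmp D (Fob F (R A)) (Fob F (R B)) (Fob F (R K)) (t B K g) (t A B f)"
      unfolding t_def using ABK fg
      by (simp add: Cmp_assoc[OF D] FR eA dA Cmp_in_Arr[OF D] ed')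
    then show "Fmor G A K (Cmp D A B K g f) =
        Cmp C (Fob G A) (Fob G B) (Fob G K) (Fmor G B K g) (Fmor G A B f)"
      using ABK fg
      by (intro Fmor_inj[of "R A" "R K"])
        (simp_all add: R I t FR Cmp_in_Arr[OF C] Cmp_in_Arr[OF D] is_functor_Cmp[OF F])
  qed (simp_all add: R I t)
  moreover have "naturally_isomorphic C C id_functor (comp_functor G F)"
    unfolding naturally_isomorphic_def
  proof (intro exI conjI)
    \<comment> \<open>The unit at \<open>X\<close> is the arrow that \<open>F\<close> sends to the
      inverse \<open>d (Fob F X)\<close> of the chosen isomorphism.\<close>
    let ?\<eta> = "\<lambda>X. I X (R (Fob F X)) (d (Fob F X))"
    have \<eta>: "?\<eta> X \<in> Arr C X (R (Fob F X))" if "X \<in> Ob C" for X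
      using that by (intro I(1)) (auto intro: R dA Fob)
    show "is_nat_trans C C id_functor (comp_functor G F) ?\<eta>"
      unfolding is_nat_trans_def
    proof (intro conjI ballI)
      fix X Y f assume "X \<in> Ob C" "Y \<in> Ob C" "f \<in> Arr C X Y"
      note * = this Fob[OF this(1)] Fob[OF this(2)] is_functor_Fmor[OF F this]
      have key: "Cmp D (Fob F X) (Fob F (R (Fob F X))) (Fob F (R (Fob F Y)))
          (t (Fob F X) (Fob F Y) (Fmor F X Y f)) (d (Fob F X)) =
        Cmp D (Fob F X) (Fob F Y) (Fob F (R (Fob F Y))) (d (Fob F Y)) (Fmor F X Y f)"
        unfolding t_def using *
        by (simp add: Cmp_assoc[OF D] FR eA dA Cmp_in_Arr[OF D] ed Cmp_Ide_right[OF D])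
      show "Cmp C (Fob id_functor X) (Fob id_functor Y) (Fob (comp_functor G F) Y) (?\<eta> Y) (Fmor id_functor X Y f) =
        Cmp C (Fob id_functor X) (Fob (comp_functor G F) X) (Fob (comp_functor G F) Y)
          (Fmor (comp_functor G F) X Y f) (?\<eta> X)"
        using * key
        by (intro Fmor_inj[of X "R (Fob F Y)"])
          (simp_all add: comp_functor_def id_functor_def R I t \<eta> Cmp_in_Arr[OF C] is_functor_Cmp[OF F] dA FR)
    qed (simp add: comp_functor_def id_functor_def \<eta>)
    show "\<forall>X\<in>Ob C. is_iso C (Fob id_functor X) (Fob (comp_functor G F) X) (?\<eta> X)"
    proof
      fix X assume X: "X \<in> Ob C"
      let ?\<epsilon> = "I (R (Fob F X)) X (e (Fob F X))"
      note * = X Fob[OF X]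
      have \<epsilon>: "?\<epsilon> \<in> Arr C (R (Fob F X)) X"
        using * by (intro I(1)) (auto intro: R eA)
      moreover have "Cmp C X (R (Fob F X)) X ?\<epsilon> (?\<eta> X) = Ide C X"
        using * \<epsilon> \<eta>[OF X] by (intro Fmor_inj[of X X])
          (simp_all add: R I eA dA Cmp_in_Arr[OF C] Ide_in_Arr[OF C] is_functor_Cmp[OF F] is_functor_Ide[OF F] ed)
      moreover have "Cmp C (R (Fob F X)) X (R (Fob F X)) (?\<eta> X) ?\<epsilon> = Ide C (R (Fob F X))"
        using * \<epsilon> \<eta>[OF X] by (intro Fmor_inj[of "R (Fob F X)" "R (Fob F X)"])
          (simp_all add: R I eA dA Cmp_in_Arr[OF C] Ide_in_Arr[OF C] is_functor_Cmp[OF F] is_functor_Ide[OF F] de)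
      ultimately show "is_iso C (Fob id_functor X) (Fob (comp_functor G F) X) (?\<eta> X)"
        using \<eta>[OF X] by (auto simp: is_iso_def comp_functor_def id_functor_def)
    qed
  qed
  moreover have "naturally_isomorphic D D (comp_functor F G) id_functor"
    unfolding naturally_isomorphic_def
  proof (intro exI conjI)
    \<comment> \<open>The counit is the family \<open>e\<close> itself; naturality is cancellation
      of \<open>d B\<close> against \<open>e B\<close> in the conjugate.\<close>
    have "Cmp D (Fob F (R A)) (Fob F (R B)) B (e B) (t A B f) = Cmp D (Fob F (R A)) A B f (e A)"
      if "A \<in> Ob D" "B \<in> Ob D" "f \<in> Arr D A B" for A B f
      unfolding t_def using that by (simp add: ed' FR eA Cmp_in_Arr[OF D])
    then show "is_nat_trans D D (comp_functor F G) id_functor e"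
      by (simp add: is_nat_trans_def comp_functor_def id_functor_def eA R I t)
    show "\<forall>A\<in>Ob D. is_iso D (Fob (comp_functor F G) A) (Fob id_functor A) (e A)"
      by (simp add: comp_functor_def id_functor_def e)
  qed
  ultimately show ?thesis
    unfolding is_equivalence_def using C D F by blast
qed


section \<open>Presheaves on a category with projective covers\<close>

text \<open>The action maps are extensional, so equality on the elements of \<open>Fob F X\<close>
  is equality of arrows of \<open>Sets_cat\<close>; the functor laws may therefore be checked on
  elements.\<close>

lemma presheafI:
  assumes "\<And>X. X \<in> Ob C \<Longrightarrow> Fob F X \<in> \<U>"
    and "\<And>X Y f. X \<in> Ob C \<Longrightarrow> Y \<in> Ob C \<Longrightarrow> f \<in> Arr C Y X \<Longrightarrow> Fmor F X Y f \<in> Fob F X \<rightarrow>\<^sub>E Fob F Y"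
    and "\<And>X x. X \<in> Ob C \<Longrightarrow> x \<in> Fob F X \<Longrightarrow> Fmor F X X (Ide C X) x = x"
    and "\<And>X Y Z f g x. X \<in> Ob C \<Longrightarrow> Y \<in> Ob C \<Longrightarrow> Z \<in> Ob C \<Longrightarrow> f \<in> Arr C Y X \<Longrightarrow> g \<in> Arr C Z Y \<Longrightarrow>
      x \<in> Fob F X \<Longrightarrow> Fmor F X Z (Cmp C Z Y X f g) x = Fmor F Y Z g (Fmor F X Y f x)"
    and C: "is_category C"
  shows "is_functor (op_cat C) (Sets_cat \<U>) F"
  unfolding is_functor_def
proof (intro conjI ballI)
  fix X assume X: "X \<in> Ob (op_cat C)"
  then have "Fmor F X X (Ide C X) \<in> Fob F X \<rightarrow>\<^sub>E Fob F X"
    using assms(2) Ide_in_Arr[OF C] by simp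
  then show "Fmor F X X (Ide (op_cat C) X) = Ide (Sets_cat \<U>) (Fob F X)"
    using X assms(3) by (fastforce simp: PiE_iff extensional_def)
next
  fix X Y Z f g
  assume X: "X \<in> Ob (op_cat C)" "Y \<in> Ob (op_cat C)" "Z \<in> Ob (op_cat C)"
    and "f \<in> Arr (op_cat C) X Y" "g \<in> Arr (op_cat C) Y Z"
  then have fg: "f \<in> Arr C Y X" "g \<in> Arr C Z Y" "Cmp C Z Y X f g \<in> Arr C Z X"
    using Cmp_in_Arr[OF C] by auto
  then have "Fmor F X Z (Cmp C Z Y X f g) \<in> Fob F X \<rightarrow>\<^sub>E Fob F Z"
    using assms(2) X by simp
  then show "Fmor F X Z (Cmp (op_cat C) X Y Z g f) =
      Cmp (Sets_cat \<U>) (Fob F X) (Fob F Y) (Fob F Z) (Fmor F Y Z g) (Fmor F X Y f)"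
    using assms(4) X fg by (auto simp: PiE_iff extensional_def compose_def)
qed (use assms in auto)

lemma nat_trans_SetsI:
  assumes "\<And>X. X \<in> Ob C \<Longrightarrow> \<eta> X \<in> Fob F X \<rightarrow>\<^sub>E Fob G X"
    and "\<And>X Y f x. X \<in> Ob C \<Longrightarrow> Y \<in> Ob C \<Longrightarrow> f \<in> Arr C X Y \<Longrightarrow> x \<in> Fob F X \<Longrightarrow>
      \<eta> Y (Fmor F X Y f x) = Fmor G X Y f (\<eta> X x)"
  shows "is_nat_trans C (Sets_cat \<U>) F G \<eta>"
  using assms by (auto simp: is_nat_trans_def compose_def restrict_def)

text \<open>Pointwise inverses of a natural transformation are natural again: write an element of
  \<open>Fob G X\<close> as the image of its preimage, use naturality of \<eta>, and cancel.\<close>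

lemma is_iso_presheafI:
  assumes F: "F \<in> Ob (functor_cat C (Sets_cat \<U>))" and G: "G \<in> Ob (functor_cat C (Sets_cat \<U>))"
    and \<eta>: "\<eta> \<in> Arr (functor_cat C (Sets_cat \<U>)) F G"
    and bij: "\<And>X. X \<in> Ob C \<Longrightarrow> bij_betw (\<eta> X) (Fob F X) (Fob G X)"
  shows "is_iso (functor_cat C (Sets_cat \<U>)) F G \<eta>"
proof -
  have nat: "is_nat_trans C (Sets_cat \<U>) F G \<eta>" and ext: "\<eta> \<in> extensional (Ob C)"
    using \<eta> by auto
  define \<theta> where "\<theta> = (\<lambda>X\<in>Ob C. restrict (inv_into (Fob F X) (\<eta> X)) (Fob G X))"
  have \<theta>: "\<theta> X y \<in> Fob F X" "\<eta> X (\<theta> X y) = y" if "X \<in> Ob C" "y \<in> Fob G X" for X y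
    using bij[OF that(1)] that by (auto simp: \<theta>_def bij_betw_def inv_into_into f_inv_into_f)
  have \<theta>\<eta>: "\<theta> X (\<eta> X x) = x" if "X \<in> Ob C" "x \<in> Fob F X" for X x
    using bij[OF that(1)] that by (auto simp: \<theta>_def bij_betw_def)
  have \<eta>_app: "\<eta> X x \<in> Fob G X" if "X \<in> Ob C" "x \<in> Fob F X" for X x
    using bij[OF that(1)] that by (auto simp: bij_betw_def)
  have mor: "Fmor F X Y f x \<in> Fob F Y" if "X \<in> Ob C" "Y \<in> Ob C" "f \<in> Arr C X Y" "x \<in> Fob F X" for X Y f x
    using is_functor_Fmor[of C "Sets_cat \<U>" F X Y f] F that by auto
  have comm: "\<eta> Y (Fmor F X Y f x) = Fmor G X Y f (\<eta> X x)"
    if "X \<in> Ob C" "Y \<in> Ob C" "f \<in> Arr C X Y" "x \<in> Fob F X" for X Y f x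
    using fun_cong[OF nat_trans_comm[OF nat that(1-3)], of x] that(4) by (simp add: compose_def)
  have "is_nat_trans C (Sets_cat \<U>) G F \<theta>"
  proof (rule nat_trans_SetsI)
    fix X Y f y assume XY: "X \<in> Ob C" "Y \<in> Ob C" "f \<in> Arr C X Y" "y \<in> Fob G X"
    have "\<theta> Y (Fmor G X Y f y) = \<theta> Y (\<eta> Y (Fmor F X Y f (\<theta> X y)))"
      using XY by (simp add: comm \<theta>)
    also have "\<dots> = Fmor F X Y f (\<theta> X y)"
      using XY by (intro \<theta>\<eta> mor \<theta>)
    finally show "\<theta> Y (Fmor G X Y f y) = Fmor F X Y f (\<theta> X y)" .
  next
    fix X assume X: "X \<in> Ob C"
    then show "\<theta> X \<in> Fob G X \<rightarrow>\<^sub>E Fob F X"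
      using \<theta>(1)[OF X] by (auto simp: \<theta>_def)
  qed
  moreover have "\<theta> \<in> extensional (Ob C)"
    by (simp add: \<theta>_def)
  ultimately show ?thesis
    using \<eta> by (auto simp: is_iso_def fun_eq_iff compose_def \<theta>\<eta> \<theta> intro!: exI[of _ \<theta>])
qed

text \<open>Collects the element-level laws of a contravariant functor to sets, so that the reversal
  of arrows in \<open>op_cat\<close> is dealt with once.\<close>

locale presheaf =
  fixes C :: "('o, 'm) category" and \<U> :: "'u set set" and F
  assumes in_functor_cat: "F \<in> Ob (functor_cat (op_cat C) (Sets_cat \<U>))"
begin

lemma is_functor: "is_functor (op_cat C) (Sets_cat \<U>) F"
  using in_functor_cat by simp

lemma Fob: "X \<in> Ob C \<Longrightarrow> Fob F X \<in> \<U>"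
  using is_functor_Fob[OF is_functor] by simp

lemma Fmor: "X \<in> Ob C \<Longrightarrow> Y \<in> Ob C \<Longrightarrow> f \<in> Arr C Y X \<Longrightarrow> Fmor F X Y f \<in> Fob F X \<rightarrow>\<^sub>E Fob F Y"
  using is_functor_Fmor[OF is_functor] by simp

lemma Fmor_app: "X \<in> Ob C \<Longrightarrow> Y \<in> Ob C \<Longrightarrow> f \<in> Arr C Y X \<Longrightarrow> x \<in> Fob F X \<Longrightarrow> Fmor F X Y f x \<in> Fob F Y"
  using Fmor by blast

lemma Fmor_Ide: "X \<in> Ob C \<Longrightarrow> x \<in> Fob F X \<Longrightarrow> Fmor F X X (Ide C X) x = x"
  using is_functor_Ide[OF is_functor] by simp

lemma Fmor_Cmp:
  "X \<in> Ob C \<Longrightarrow> Y \<in> Ob C \<Longrightarrow> Z \<in> Ob C \<Longrightarrow> f \<in> Arr C Y X \<Longrightarrow> g \<in> Arr C Z Y \<Longrightarrow> x \<in> Fob F X \<Longrightarrow>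
   Fmor F Y Z g (Fmor F X Y f x) = Fmor F X Z (Cmp C Z Y X f g) x"
  using is_functor_Cmp[OF is_functor, of X Y Z f g] by (simp add: compose_def)

end

lemma presheaf_nat_app:
  "\<eta> \<in> Arr (functor_cat (op_cat C) (Sets_cat \<U>)) F G \<Longrightarrow> X \<in> Ob C \<Longrightarrow> x \<in> Fob F X \<Longrightarrow> \<eta> X x \<in> Fob G X"
  using nat_trans_Arr[of "op_cat C" "Sets_cat \<U>" F G \<eta> X] by auto

lemma presheaf_nat_comm:
  assumes "\<eta> \<in> Arr (functor_cat (op_cat C) (Sets_cat \<U>)) F G"
    "X \<in> Ob C" "Y \<in> Ob C" "f \<in> Arr C Y X" "x \<in> Fob F X"
  shows "Fmor G X Y f (\<eta> X x) = \<eta> Y (Fmor F X Y f x)"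
  using nat_trans_comm[of "op_cat C" "Sets_cat \<U>" F G \<eta> X Y f] fun_cong assms
  by (fastforce simp: compose_def restrict_def dest: fun_cong[of _ _ x])

lemma presheaf_nat_ext:
  assumes "\<eta> \<in> Arr (functor_cat (op_cat C) (Sets_cat \<U>)) F G"
    "\<theta> \<in> Arr (functor_cat (op_cat C) (Sets_cat \<U>)) F G"
    "\<And>X x. X \<in> Ob C \<Longrightarrow> x \<in> Fob F X \<Longrightarrow> \<eta> X x = \<theta> X x"
  shows "\<eta> = \<theta>"
proof (rule extensionalityI)
  fix X assume X: "X \<in> Ob C"
  have "\<eta> X \<in> Fob F X \<rightarrow>\<^sub>E Fob G X" "\<theta> X \<in> Fob F X \<rightarrow>\<^sub>E Fob G X"
    using assms X nat_trans_Arr[of "op_cat C" "Sets_cat \<U>" F G _ X] by auto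
  then show "\<eta> X = \<theta> X"
    using assms(3)[OF X] by (rule PiE_ext)
qed (use assms in auto)

text \<open>The categorical input of the equivalence, abstracted from \<open>CHaus\<close> and the
  spaces \<open>beta \<U> S\<close>. The assumption \<open>subset_copy\<close> is there because the
  extended functor takes as values subsets of values of a given functor, and these belong to \<U>
  only up to bijection.\<close>

locale projective_covers =
  fixes C :: "('o, 'm) category" and B :: "'o set" and \<U> :: "'u set set"
  assumes C: "is_category C"
    and B_sub: "B \<subseteq> Ob C"
    and projective: "\<And>A X Y f g. A \<in> B \<Longrightarrow> X \<in> Ob C \<Longrightarrow> Y \<in> Ob C \<Longrightarrow> is_epi C Y X f \<Longrightarrow> g \<in> Arr C A X \<Longrightarrow>
      \<exists>h\<in>Arr C A Y. Cmp C A Y X f h = g"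
    and ex_cover: "\<And>X. X \<in> Ob C \<Longrightarrow> \<exists>A\<in>B. \<exists>p. is_epi C A X p"
    and ex_kernel_pair: "\<And>X Y f. X \<in> Ob C \<Longrightarrow> Y \<in> Ob C \<Longrightarrow> is_epi C Y X f \<Longrightarrow> \<exists>P p q. is_kernel_pair C Y X f P p q"
    and subset_copy: "\<And>S A. S \<in> \<U> \<Longrightarrow> A \<subseteq> S \<Longrightarrow> \<exists>T\<in>\<U>. T \<approx> A"
begin

section \<open>The two presheaf categories, functors with descent, and restriction\<close>

abbreviation "hatC \<equiv> functor_cat (op_cat C) (Sets_cat \<U>)"
abbreviation "hatB \<equiv> functor_cat (op_cat (full_subcat C B)) (Sets_cat \<U>)"

definition "sheaves = {F \<in> Ob hatC.
  \<forall>X\<in>Ob C. \<forall>Y\<in>Ob C. \<forall>f. is_epi C Y X f \<longrightarrow>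
    (\<forall>P p q. is_kernel_pair C Y X f P p q \<longrightarrow>
       bij_betw (Fmor F X Y f) (Fob F X) {y \<in> Fob F Y. Fmor F Y P p y = Fmor F Y P q y})}"

text \<open>Written in the literal shape of \<open>Res\<close>, so that the two coincide on
  unfolding; the annotations fix the types of arguments that the body leaves open.\<close>

definition "res = \<lparr>Fob = restrict_functor (op_cat (full_subcat C B)),
  Fmor = (\<lambda>(F :: ('o, 'm, 'u set, 'u \<Rightarrow> 'u) cat_functor) (G :: ('o, 'm, 'u set, 'u \<Rightarrow> 'u) cat_functor)
    (\<eta> :: 'o \<Rightarrow> 'u \<Rightarrow> 'u). restrict \<eta> (Ob (full_subcat C B)))\<rparr>"

lemma B_Ob: "A \<in> B \<Longrightarrow> A \<in> Ob C"
  using B_sub by blast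

lemma restrict_functor_simps [simp]:
  "X \<in> B \<Longrightarrow> Fob (restrict_functor (op_cat (full_subcat C B)) F) X = Fob F X"
  "X \<in> B \<Longrightarrow> Y \<in> B \<Longrightarrow> f \<in> Arr C Y X \<Longrightarrow>
   Fmor (restrict_functor (op_cat (full_subcat C B)) F) X Y f = Fmor F X Y f"
  by (simp_all add: restrict_functor_def)

lemma res_simps [simp]:
  "Fob res F = restrict_functor (op_cat (full_subcat C B)) F"
  "Fmor res F G \<eta> = restrict \<eta> B"
  by (simp_all add: res_def)

lemma restrict_functor_in_hatB:
  assumes F: "F \<in> Ob hatC"
  shows "restrict_functor (op_cat (full_subcat C B)) F \<in> Ob hatB"
proof -
  interpret F: presheaf C \<U> F
    using F by unfold_locales
  let ?R = "restrict_functor (op_cat (full_subcat C B)) F"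
  have "is_functor (op_cat (full_subcat C B)) (Sets_cat \<U>) ?R"
    by (rule presheafI)
      (simp_all add: B_Ob F.Fob F.Fmor F.Fmor_Ide F.Fmor_Cmp[symmetric] Ide_in_Arr[OF C] Cmp_in_Arr[OF C]
        is_category_full_subcat[OF C B_sub] del: PiE_iff)
  moreover have "restrict_functor (op_cat (full_subcat C B)) ?R = ?R"
    by (auto simp: restrict_functor_def fun_eq_iff)
  ultimately show ?thesis
    by simp
qed

lemma restrict_nat_in_hatB:
  assumes "F \<in> Ob hatC" "G \<in> Ob hatC" and \<eta>: "\<eta> \<in> Arr hatC F G"
  shows "restrict \<eta> B \<in> Arr hatB (Fob res F) (Fob res G)"
  using \<eta> B_sub by (auto simp: is_nat_trans_def subset_iff)

lemma is_functor_res: "is_functor hatC hatB res"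
  unfolding is_functor_def
proof (intro conjI ballI)
  fix F G H \<eta> \<theta>
  assume "F \<in> Ob hatC" "G \<in> Ob hatC" "H \<in> Ob hatC" "\<eta> \<in> Arr hatC F G" "\<theta> \<in> Arr hatC G H"
  show "Fmor res F H (Cmp hatC F G H \<theta> \<eta>) =
      Cmp hatB (Fob res F) (Fob res G) (Fob res H) (Fmor res G H \<theta>) (Fmor res F G \<eta>)"
    by (auto simp: fun_eq_iff B_Ob)
next
  fix F assume "F \<in> Ob hatC"
  show "Fmor res F F (Ide hatC F) = Ide hatB (Fob res F)"
    by (auto simp: fun_eq_iff B_Ob)
next
  fix F G \<eta> assume "F \<in> Ob hatC" "G \<in> Ob hatC" "\<eta> \<in> Arr hatC F G"
  then show "Fmor res F G \<eta> \<in> Arr hatB (Fob res F) (Fob res G)"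
    unfolding res_simps(2) by (rule restrict_nat_in_hatB)
next
  fix F assume "F \<in> Ob hatC"
  then show "Fob res F \<in> Ob hatB"
    unfolding res_simps(1) by (rule restrict_functor_in_hatB)
qed

text \<open>One fixed cover per object. For \<open>X\<close> in \<open>B\<close> the choice need not
  be \<open>X\<close> itself, so even on \<open>B\<close> comparisons pass through
  \<open>prj X\<close>.\<close>

definition "cov X = (SOME A. A \<in> B \<and> (\<exists>p. is_epi C A X p))"
definition "prj X = (SOME p. is_epi C (cov X) X p)"

lemma cov: "X \<in> Ob C \<Longrightarrow> cov X \<in> B" and prj_epi: "X \<in> Ob C \<Longrightarrow> is_epi C (cov X) X (prj X)"
proof -
  assume "X \<in> Ob C"
  then have "cov X \<in> B \<and> (\<exists>p. is_epi C (cov X) X p)"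
    unfolding cov_def using ex_cover by (intro someI_ex[where P = "\<lambda>A. A \<in> B \<and> (\<exists>p. is_epi C A X p)"]) blast
  then show "cov X \<in> B" "is_epi C (cov X) X (prj X)"
    unfolding prj_def by (auto intro: someI_ex)
qed

lemma cov_Ob: "X \<in> Ob C \<Longrightarrow> cov X \<in> Ob C"
  using cov B_Ob by blast

lemma epi_Arr: "is_epi C X Y f \<Longrightarrow> f \<in> Arr C X Y"
  by (simp add: is_epi_def)

lemma prj: "X \<in> Ob C \<Longrightarrow> prj X \<in> Arr C (cov X) X"
  using prj_epi epi_Arr by blast

text \<open>\<open>cov X\<close> is projective and \<open>prj Y\<close> is epi. The lift is not
  unique in general; constructions that use one must be insensitive to the choice.\<close>

lemma ex_lift:
  assumes "X \<in> Ob C" "Y \<in> Ob C" "f \<in> Arr C X Y"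
  shows "\<exists>h\<in>Arr C (cov X) (cov Y). Cmp C (cov X) (cov Y) Y (prj Y) h = Cmp C (cov X) X Y f (prj X)"
  using assms by (intro projective Cmp_in_Arr[OF C] cov cov_Ob prj prj_epi)

section \<open>Descent tested on the projective objects\<close>

lemma sheaf_inj:
  assumes F: "F \<in> sheaves" and XY: "X \<in> Ob C" "Y \<in> Ob C" and f: "is_epi C Y X f"
    and x: "x \<in> Fob F X" "x' \<in> Fob F X" "Fmor F X Y f x = Fmor F X Y f x'"
  shows "x = x'"
proof -
  \<comment> \<open>Descent is a statement about every kernel pair of \<open>f\<close>, so it says
    something only once a kernel pair is at hand.\<close>
  obtain P p q where "is_kernel_pair C Y X f P p q"
    using ex_kernel_pair[OF XY f] by blast
  then have "inj_on (Fmor F X Y f) (Fob F X)"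
    using F XY f by (auto simp: sheaves_def bij_betw_def)
  then show ?thesis
    using x by (auto dest: inj_onD)
qed

lemma sheaf_cov_inj:
  "F \<in> sheaves \<Longrightarrow> X \<in> Ob C \<Longrightarrow> x \<in> Fob F X \<Longrightarrow> x' \<in> Fob F X \<Longrightarrow>
   Fmor F X (cov X) (prj X) x = Fmor F X (cov X) (prj X) x' \<Longrightarrow> x = x'"
  by (rule sheaf_inj[OF _ _ cov_Ob prj_epi])

text \<open>Compatibility over objects of \<open>B\<close> is enough because the kernel pair of
  \<open>f\<close> is itself covered by such an object, and \<open>F\<close> is injective along that
  cover.\<close>

lemma sheaf_glue:
  assumes F: "F \<in> sheaves" and XY: "X \<in> Ob C" "Y \<in> Ob C" and f: "is_epi C Y X f"
    and y: "y \<in> Fob F Y"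
    and compat: "\<And>A a a'. A \<in> B \<Longrightarrow> a \<in> Arr C A Y \<Longrightarrow> a' \<in> Arr C A Y \<Longrightarrow>
      Cmp C A Y X f a = Cmp C A Y X f a' \<Longrightarrow> Fmor F Y A a y = Fmor F Y A a' y"
  shows "\<exists>x\<in>Fob F X. Fmor F X Y f x = y"
proof -
  interpret F: presheaf C \<U> F
    using F by unfold_locales (simp add: sheaves_def)
  obtain P p q where k: "is_kernel_pair C Y X f P p q"
    using ex_kernel_pair[OF XY f] by blast
  then have pq: "P \<in> Ob C" "p \<in> Arr C P Y" "q \<in> Arr C P Y" "Cmp C P Y X f p = Cmp C P Y X f q"
    by (simp_all add: is_kernel_pair_def)
  note * = XY pq cov_Ob[OF pq(1)] prj[OF pq(1)] epi_Arr[OF f]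
  \<comment> \<open>The two projections, precomposed with \<open>prj P\<close>, form a test pair
    with source \<open>cov P\<close>, which lies in \<open>B\<close>.\<close>
  have "Fmor F Y (cov P) (Cmp C (cov P) P Y p (prj P)) y = Fmor F Y (cov P) (Cmp C (cov P) P Y q (prj P)) y"
    using * by (intro compat) (simp_all add: cov Cmp_in_Arr[OF C] Cmp_assoc[OF C, symmetric])
  then have "Fmor F P (cov P) (prj P) (Fmor F Y P p y) = Fmor F P (cov P) (prj P) (Fmor F Y P q y)"
    using * y by (simp add: F.Fmor_Cmp)
  then have "Fmor F Y P p y = Fmor F Y P q y"
    by (intro sheaf_cov_inj[OF F pq(1) F.Fmor_app[OF XY(2) pq(1,2) y] F.Fmor_app[OF XY(2) pq(1,3) y]])
  then have "y \<in> {y \<in> Fob F Y. Fmor F Y P p y = Fmor F Y P q y}"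
    using y by blast
  moreover have "bij_betw (Fmor F X Y f) (Fob F X) {y \<in> Fob F Y. Fmor F Y P p y = Fmor F Y P q y}"
    using F XY f k by (auto simp: sheaves_def)
  ultimately have "y \<in> Fmor F X Y f ` Fob F X"
    by (simp only: bij_betw_imp_surj_on)
  then show ?thesis
    by blast
qed

section \<open>Restriction is fully faithful on functors with descent\<close>

lemma res_faithful:
  assumes F: "F \<in> Ob hatC" and G: "G \<in> sheaves" and \<eta>: "\<eta> \<in> Arr hatC F G" and \<theta>: "\<theta> \<in> Arr hatC F G"
    and eq: "restrict \<eta> B = restrict \<theta> B"
  shows "\<eta> = \<theta>"
proof (rule presheaf_nat_ext[OF \<eta> \<theta>])
  interpret F: presheaf C \<U> F
    using F by unfold_locales
  fix X x assume X: "X \<in> Ob C" and x: "x \<in> Fob F X"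
  \<comment> \<open>The cover lies in \<open>B\<close>, where the two agree by assumption;
    naturality along \<open>prj X\<close> and injectivity of \<open>G\<close> along
    \<open>prj X\<close> carry this back to \<open>X\<close>.\<close>
  have "\<eta> (cov X) = \<theta> (cov X)"
    using fun_cong[OF eq, of "cov X"] cov[OF X] by simp
  then have "Fmor G X (cov X) (prj X) (\<eta> X x) = Fmor G X (cov X) (prj X) (\<theta> X x)"
    using X x by (simp add: presheaf_nat_comm[OF \<eta>] presheaf_nat_comm[OF \<theta>] cov_Ob prj)
  then show "\<eta> X x = \<theta> X x"
    by (rule sheaf_cov_inj[OF G X presheaf_nat_app[OF \<eta> X x] presheaf_nat_app[OF \<theta> X x]])
qed

text \<open>The component at \<open>X\<close> is forced: restrict to \<open>cov X\<close>, apply the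
  given component there, and glue the result in \<open>G\<close>. Uniqueness of gluing then yields
  naturality and agreement with the given transformation on \<open>B\<close>.\<close>

lemma res_full:
  assumes F: "F \<in> Ob hatC" and G: "G \<in> sheaves" and \<eta>: "\<eta> \<in> Arr hatB (Fob res F) (Fob res G)"
  shows "\<exists>\<theta>\<in>Arr hatC F G. restrict \<theta> B = \<eta>"
proof -
  interpret F: presheaf C \<U> F
    using F by unfold_locales
  interpret G: presheaf C \<U> G
    using G by unfold_locales (simp add: sheaves_def)
  have \<eta>_app: "\<eta> X x \<in> Fob G X" if "X \<in> B" "x \<in> Fob F X" for X x
    using presheaf_nat_app[OF \<eta>] that by simp
  have \<eta>_comm: "Fmor G X Y f (\<eta> X x) = \<eta> Y (Fmor F X Y f x)"
    if "X \<in> B" "Y \<in> B" "f \<in> Arr C Y X" "x \<in> Fob F X" for X Y f x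
    using presheaf_nat_comm[OF \<eta>, of X Y f x] that by simp
  have "\<exists>z\<in>Fob G X. Fmor G X (cov X) (prj X) z = \<eta> (cov X) (Fmor F X (cov X) (prj X) x)"
    if X: "X \<in> Ob C" and x: "x \<in> Fob F X" for X x
  proof (rule sheaf_glue[OF G X cov_Ob[OF X] prj_epi[OF X]])
    note * = X x cov[OF X] cov_Ob[OF X] prj[OF X]
    then show "\<eta> (cov X) (Fmor F X (cov X) (prj X) x) \<in> Fob G (cov X)"
      by (intro \<eta>_app F.Fmor_app)
    fix A a a' assume "A \<in> B" "a \<in> Arr C A (cov X)" "a' \<in> Arr C A (cov X)"
      "Cmp C A (cov X) X (prj X) a = Cmp C A (cov X) X (prj X) a'"
    \<comment> \<open>Naturality of \<eta> over \<open>B\<close> moves \<open>a\<close> and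
      \<open>a'\<close> inside, where both act on \<open>x\<close> through the same composite to
      \<open>X\<close>.\<close>
    then show "Fmor G (cov X) A a (\<eta> (cov X) (Fmor F X (cov X) (prj X) x)) =
        Fmor G (cov X) A a' (\<eta> (cov X) (Fmor F X (cov X) (prj X) x))"
      using * by (simp add: \<eta>_comm F.Fmor_app F.Fmor_Cmp B_Ob)
  qed
  then obtain t where t: "\<And>X x. X \<in> Ob C \<Longrightarrow> x \<in> Fob F X \<Longrightarrow> t X x \<in> Fob G X"
    "\<And>X x. X \<in> Ob C \<Longrightarrow> x \<in> Fob F X \<Longrightarrow>
      Fmor G X (cov X) (prj X) (t X x) = \<eta> (cov X) (Fmor F X (cov X) (prj X) x)"
    by metis
  define \<theta> where "\<theta> = (\<lambda>X\<in>Ob C. restrict (t X) (Fob F X))"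
  have "is_nat_trans (op_cat C) (Sets_cat \<U>) F G \<theta>"
  proof (rule nat_trans_SetsI)
    fix X assume "X \<in> Ob (op_cat C)"
    then show "\<theta> X \<in> Fob F X \<rightarrow>\<^sub>E Fob G X"
      using t(1) by (auto simp: \<theta>_def)
  next
    fix Y X f x assume "Y \<in> Ob (op_cat C)" "X \<in> Ob (op_cat C)" "f \<in> Arr (op_cat C) Y X" and x: "x \<in> Fob F Y"
    then have XY: "X \<in> Ob C" "Y \<in> Ob C" and f: "f \<in> Arr C X Y"
      by auto
    \<comment> \<open>The arrow \<open>f\<close> need not lie in \<open>B\<close>, so the given
      naturality does not apply to it; it applies to the lift \<open>h\<close>, and the square with
      the projections transfers the result.\<close>
    obtain h where h: "h \<in> Arr C (cov X) (cov Y)"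
      "Cmp C (cov X) (cov Y) Y (prj Y) h = Cmp C (cov X) X Y f (prj X)"
      using ex_lift[OF XY f] by blast
    note * = XY x f h(1) cov[OF XY(1)] cov[OF XY(2)] cov_Ob[OF XY(1)] cov_Ob[OF XY(2)] prj[OF XY(1)] prj[OF XY(2)]
    have "Fmor G X (cov X) (prj X) (t X (Fmor F Y X f x)) = \<eta> (cov X) (Fmor F X (cov X) (prj X) (Fmor F Y X f x))"
      using * by (intro t F.Fmor_app)
    also have "\<dots> = \<eta> (cov X) (Fmor F (cov Y) (cov X) h (Fmor F Y (cov Y) (prj Y) x))"
      using * by (simp add: F.Fmor_Cmp h(2))
    also have "\<dots> = Fmor G (cov Y) (cov X) h (Fmor G Y (cov Y) (prj Y) (t Y x))"
      using * by (simp add: \<eta>_comm t F.Fmor_app)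
    also have "\<dots> = Fmor G X (cov X) (prj X) (Fmor G Y X f (t Y x))"
      using * by (simp add: G.Fmor_Cmp h(2) t(1))
    finally have "t X (Fmor F Y X f x) = Fmor G Y X f (t Y x)"
      by (rule sheaf_cov_inj[OF G XY(1), rotated 2]) (use * in \<open>simp_all add: t G.Fmor_app F.Fmor_app\<close>)
    then show "\<theta> X (Fmor F Y X f x) = Fmor G Y X f (\<theta> Y x)"
      using * by (simp add: \<theta>_def F.Fmor_app)
  qed
  then have \<theta>: "\<theta> \<in> Arr hatC F G"
    by (simp add: \<theta>_def)
  have G': "G \<in> Ob hatC"
    using G by (simp add: sheaves_def)
  have "restrict \<theta> B = \<eta>"
  proof (rule presheaf_nat_ext[OF _ \<eta>])
    show "restrict \<theta> B \<in> Arr hatB (Fob res F) (Fob res G)"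
      using restrict_nat_in_hatB[OF F G' \<theta>] .
    fix X x assume "X \<in> Ob (full_subcat C B)" "x \<in> Fob (Fob res F) X"
    then have X: "X \<in> B" and x: "x \<in> Fob F X"
      by auto
    note * = X x B_Ob[OF X] cov[OF B_Ob[OF X]] prj[OF B_Ob[OF X]] cov_Ob[OF B_Ob[OF X]]
    \<comment> \<open>Here \<open>prj X\<close> has both ends in \<open>B\<close>, so \<eta> is
      natural along it.\<close>
    have "Fmor G X (cov X) (prj X) (t X x) = Fmor G X (cov X) (prj X) (\<eta> X x)"
      using * by (simp add: \<eta>_comm t)
    then have "t X x = \<eta> X x"
      by (rule sheaf_cov_inj[OF G B_Ob[OF X], rotated 2]) (use * in \<open>simp_all add: t \<eta>_app\<close>)
    then show "restrict \<theta> B X x = \<eta> X x"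
      using * by (simp add: \<theta>_def)
  qed
  then show ?thesis
    using \<theta> by blast
qed

section \<open>Extension of a functor from the projective objects to all objects\<close>

lemma res_ess_surj:
  assumes G: "G \<in> Ob hatB"
  shows "\<exists>F\<in>sheaves. \<exists>\<epsilon>. is_iso hatB (Fob res F) G \<epsilon>"
proof -
  interpret G: presheaf "full_subcat C B" \<U> G
    using G by unfold_locales
  note Gapp = G.Fmor_app[simplified] and GIde = G.Fmor_Ide[simplified] and GCmp = G.Fmor_Cmp[simplified]
  \<comment> \<open>A kernel pair of \<open>prj X\<close> need not lie in \<open>B\<close>, where
    \<open>G\<close> lives, so the equaliser is replaced by a condition on all test pairs with
    source in \<open>B\<close>.\<close>
  define E where "E X = {y \<in> Fob G (cov X). \<forall>A\<in>B. \<forall>a\<in>Arr C A (cov X). \<forall>a'\<in>Arr C A (cov X).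
    Cmp C A (cov X) X (prj X) a = Cmp C A (cov X) X (prj X) a' \<longrightarrow>
    Fmor G (cov X) A a y = Fmor G (cov X) A a' y}" for X
  have EG: "y \<in> Fob G (cov X)" if "y \<in> E X" for X y
    using that by (simp add: E_def)
  have E_eq: "Fmor G (cov X) A a y = Fmor G (cov X) A a' y"
    if "y \<in> E X" "A \<in> B" "a \<in> Arr C A (cov X)" "a' \<in> Arr C A (cov X)"
      "Cmp C A (cov X) X (prj X) a = Cmp C A (cov X) X (prj X) a'" for X A a a' y
    using that unfolding E_def by blast
  \<comment> \<open>Stated for an arbitrary lift \<open>h\<close> of \<open>f\<close>. Test arrows
    that agree over \<open>Y\<close> still agree over \<open>X\<close> after composing with
    \<open>h\<close>, because \<open>h\<close> covers \<open>f\<close>.\<close>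
  have E_map: "Fmor G (cov X) (cov Y) h y \<in> E Y"
    if X: "X \<in> Ob C" and Y: "Y \<in> Ob C" and f: "f \<in> Arr C Y X" and h: "h \<in> Arr C (cov Y) (cov X)"
      and hf: "Cmp C (cov Y) (cov X) X (prj X) h = Cmp C (cov Y) Y X f (prj Y)" and y: "y \<in> E X" for X Y f h y
  proof -
    note * = X Y f h EG[OF y] cov[OF X] cov[OF Y] cov_Ob[OF X] cov_Ob[OF Y] prj[OF X] prj[OF Y]
    have "Fmor G (cov Y) A a (Fmor G (cov X) (cov Y) h y) = Fmor G (cov Y) A a' (Fmor G (cov X) (cov Y) h y)"
      if a: "A \<in> B" "a \<in> Arr C A (cov Y)" "a' \<in> Arr C A (cov Y)"
        "Cmp C A (cov Y) Y (prj Y) a = Cmp C A (cov Y) Y (prj Y) a'" for A a a'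
    proof -
      have "Cmp C A (cov X) X (prj X) (Cmp C A (cov Y) (cov X) h a) =
          Cmp C A (cov X) X (prj X) (Cmp C A (cov Y) (cov X) h a')"
        using * a by (simp add: Cmp_assoc[OF C, symmetric] B_Ob hf) (simp add: Cmp_assoc[OF C] B_Ob)
      then have "Fmor G (cov X) A (Cmp C A (cov Y) (cov X) h a) y = Fmor G (cov X) A (Cmp C A (cov Y) (cov X) h a') y"
        using * a by (intro E_eq[OF y a(1)]) (simp_all add: Cmp_in_Arr[OF C] B_Ob)
      then show ?thesis
        using * a by (simp add: GCmp)
    qed
    moreover have "Fmor G (cov X) (cov Y) h y \<in> Fob G (cov Y)"
      using * by (simp add: Gapp)
    ultimately show ?thesis
      unfolding E_def by blast
  qed
  \<comment> \<open>\<open>E X\<close> is a subset of a member of \<U> but need not be a member;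
    \<open>T X\<close> is a copy that is, read through the bijection \<psi>.\<close>
  have "\<exists>T\<in>\<U>. \<exists>\<psi>. bij_betw \<psi> T (E X)" if X: "X \<in> Ob C" for X
    using subset_copy[OF G.Fob, of "cov X" "E X"] cov[OF X] unfolding eqpoll_def by (auto simp: E_def)
  then obtain T \<psi> where T: "\<And>X. X \<in> Ob C \<Longrightarrow> T X \<in> \<U>" and \<psi>: "\<And>X. X \<in> Ob C \<Longrightarrow> bij_betw (\<psi> X) (T X) (E X)"
    by metis
  define \<phi> where "\<phi> X = inv_into (T X) (\<psi> X)" for X
  have \<psi>E: "\<psi> X t \<in> E X" if "X \<in> Ob C" "t \<in> T X" for X t
    using bij_betwE[OF \<psi>] that by blast
  have \<phi>: "\<phi> X y \<in> T X" "\<psi> X (\<phi> X y) = y" if "X \<in> Ob C" "y \<in> E X" for X y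
    using \<psi>[OF that(1)] that(2) by (auto simp: \<phi>_def bij_betw_def inv_into_into f_inv_into_f)
  have \<phi>\<psi>: "\<phi> X (\<psi> X t) = t" if "X \<in> Ob C" "t \<in> T X" for X t
    using \<psi>[OF that(1)] that(2) by (auto simp: \<phi>_def bij_betw_def)
  have "\<forall>X Y f. \<exists>h. X \<in> Ob C \<longrightarrow> Y \<in> Ob C \<longrightarrow> f \<in> Arr C Y X \<longrightarrow> h \<in> Arr C (cov Y) (cov X) \<and>
      Cmp C (cov Y) (cov X) X (prj X) h = Cmp C (cov Y) Y X f (prj Y)"
    using ex_lift by blast
  then obtain L where L: "\<And>X Y f. X \<in> Ob C \<Longrightarrow> Y \<in> Ob C \<Longrightarrow> f \<in> Arr C Y X \<Longrightarrow> L X Y f \<in> Arr C (cov Y) (cov X)"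
    "\<And>X Y f. X \<in> Ob C \<Longrightarrow> Y \<in> Ob C \<Longrightarrow> f \<in> Arr C Y X \<Longrightarrow>
      Cmp C (cov Y) (cov X) X (prj X) (L X Y f) = Cmp C (cov Y) Y X f (prj Y)"
    by metis
  define K where "K = \<lparr>Fob = T, Fmor = (\<lambda>X Y f. \<lambda>t\<in>T X. \<phi> Y (Fmor G (cov X) (cov Y) (L X Y f) (\<psi> X t)))\<rparr>"
  \<comment> \<open>This picks the representative that is \<open>undefined\<close> off the objects
    and arrows of \<open>C\<close>, as membership in \<open>hatC\<close> demands.\<close>
  define F where "F = restrict_functor (op_cat C) K"
  have F_simps: "Fob F X = T X" if "X \<in> Ob C" for X
    using that by (simp add: F_def K_def restrict_functor_def)
  have F_mor: "Fmor F X Y f = (\<lambda>t\<in>T X. \<phi> Y (Fmor G (cov X) (cov Y) (L X Y f) (\<psi> X t)))"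
    if "X \<in> Ob C" "Y \<in> Ob C" "f \<in> Arr C Y X" for X Y f
    using that by (simp add: F_def K_def restrict_functor_def)
  have GLE: "Fmor G (cov X) (cov Y) (L X Y f) (\<psi> X t) \<in> E Y"
    if "X \<in> Ob C" "Y \<in> Ob C" "f \<in> Arr C Y X" "t \<in> T X" for X Y f t
    using that by (intro E_map[OF _ _ _ L \<psi>E])
  have F_app: "Fmor F X Y f t \<in> T Y" "\<psi> Y (Fmor F X Y f t) = Fmor G (cov X) (cov Y) (L X Y f) (\<psi> X t)"
    if "X \<in> Ob C" "Y \<in> Ob C" "f \<in> Arr C Y X" "t \<in> T X" for X Y f t
    using that GLE[OF that] by (simp_all add: F_mor \<phi>)
  have \<psi>_inj: "t = t'" if "X \<in> Ob C" "t \<in> T X" "t' \<in> T X" "\<psi> X t = \<psi> X t'" for X t t'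
    using \<phi>\<psi> that by metis
  have "is_functor (op_cat C) (Sets_cat \<U>) F"
  proof (rule presheafI[OF _ _ _ _ C])
    fix X assume "X \<in> Ob C"
    then show "Fob F X \<in> \<U>"
      by (simp add: F_simps T)
  next
    fix X Y f assume XY: "X \<in> Ob C" "Y \<in> Ob C" "f \<in> Arr C Y X"
    then show "Fmor F X Y f \<in> Fob F X \<rightarrow>\<^sub>E Fob F Y"
      using GLE[OF XY] by (simp add: F_simps F_mor \<phi>)
  next
    fix X t assume X: "X \<in> Ob C" and "t \<in> Fob F X"
    then have t: "t \<in> T X"
      by (simp add: F_simps)
    note * = X t cov[OF X] cov_Ob[OF X] prj[OF X] Ide_in_Arr[OF C X] Ide_in_Arr[OF C cov_Ob[OF X]] \<psi>E[OF X t]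
    \<comment> \<open>The chosen lift of an identity need not be an identity, but both lift
      \<open>prj X\<close>, and elements of \<open>E X\<close> cannot tell them apart.\<close>
    have "Fmor G (cov X) (cov X) (L X X (Ide C X)) (\<psi> X t) = Fmor G (cov X) (cov X) (Ide C (cov X)) (\<psi> X t)"
      using * by (intro E_eq) (simp_all add: L Cmp_Ide_left[OF C] Cmp_Ide_right[OF C])
    then have eq: "\<psi> X (Fmor F X X (Ide C X) t) = \<psi> X t"
      using * by (simp add: F_app GIde EG)
    show "Fmor F X X (Ide C X) t = t"
      by (rule \<psi>_inj[OF X _ _ eq]) (use * in \<open>simp_all add: F_app\<close>)
  next
    fix X Y Z f g t
    assume X: "X \<in> Ob C" and Y: "Y \<in> Ob C" and Z: "Z \<in> Ob C" and f: "f \<in> Arr C Y X" and g: "g \<in> Arr C Z Y"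
      and "t \<in> Fob F X"
    then have t: "t \<in> T X"
      by (simp add: F_simps)
    note * = X Y Z f g t cov[OF X] cov_Ob[OF X] prj[OF X] cov[OF Y] cov_Ob[OF Y] prj[OF Y] cov[OF Z] cov_Ob[OF Z] prj[OF Z]
      L[OF X Y f] L[OF Y Z g] \<psi>E[OF X t] Cmp_in_Arr[OF C Z Y X g f]
    \<comment> \<open>The composite of the two chosen lifts is a lift of the composite arrow, so the
      same argument applies.\<close>
    have "Cmp C (cov Z) (cov X) X (prj X) (Cmp C (cov Z) (cov Y) (cov X) (L X Y f) (L Y Z g)) =
        Cmp C (cov Z) Z X (Cmp C Z Y X f g) (prj Z)"
      using * by (simp add: Cmp_assoc[OF C, symmetric]) (simp add: Cmp_assoc[OF C])
    then have "Fmor G (cov X) (cov Z) (Cmp C (cov Z) (cov Y) (cov X) (L X Y f) (L Y Z g)) (\<psi> X t) =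
        Fmor G (cov X) (cov Z) (L X Z (Cmp C Z Y X f g)) (\<psi> X t)"
      using * by (intro E_eq) (simp_all add: L Cmp_in_Arr[OF C])
    then have eq: "\<psi> Z (Fmor F X Z (Cmp C Z Y X f g) t) = \<psi> Z (Fmor F Y Z g (Fmor F X Y f t))"
      using * by (simp add: F_app GCmp EG)
    show "Fmor F X Z (Cmp C Z Y X f g) t = Fmor F Y Z g (Fmor F X Y f t)"
      by (rule \<psi>_inj[OF Z _ _ eq]) (use * in \<open>simp_all add: F_app\<close>)
  qed
  moreover have "restrict_functor (op_cat C) F = F"
    by (auto simp: F_def restrict_functor_def fun_eq_iff)
  ultimately have F_hat: "F \<in> Ob hatC"
    by simp
  have "bij_betw (Fmor F X Y f) (Fob F X) {y \<in> Fob F Y. Fmor F Y P p y = Fmor F Y P q y}"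
    if X: "X \<in> Ob C" and Y: "Y \<in> Ob C" and epi: "is_epi C Y X f" and k: "is_kernel_pair C Y X f P p q" for X Y f P p q
  proof -
    have f: "f \<in> Arr C Y X"
      using epi by (rule epi_Arr)
    have P: "P \<in> Ob C" and p: "p \<in> Arr C P Y" and q: "q \<in> Arr C P Y" and pq: "Cmp C P Y X f p = Cmp C P Y X f q"
      using k by (simp_all add: is_kernel_pair_def)
    have univ: "\<exists>u\<in>Arr C A P. Cmp C A P Y p u = a \<and> Cmp C A P Y q u = b"
      if "A \<in> Ob C" "a \<in> Arr C A Y" "b \<in> Arr C A Y" "Cmp C A Y X f a = Cmp C A Y X f b" for A a b
      using k that unfolding is_kernel_pair_def by blast
    note * = X Y P f p q cov[OF X] cov_Ob[OF X] prj[OF X] cov[OF Y] cov_Ob[OF Y] prj[OF Y] cov[OF P] cov_Ob[OF P] prj[OF P]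
      L[OF X Y f] L[OF Y P p] L[OF Y P q]
    \<comment> \<open>Lifting \<open>prj X\<close> first through \<open>f\<close> and then through
      \<open>prj Y\<close> gives \<open>s\<close> from \<open>cov X\<close> to \<open>cov Y\<close>,
      compatible with the maps to \<open>X\<close>. It stands in for a section of \<open>f\<close>,
      which need not exist.\<close>
    obtain s0 where s0: "s0 \<in> Arr C (cov X) Y" "Cmp C (cov X) Y X f s0 = prj X"
      using projective[OF cov[OF X] X Y epi prj[OF X]] by blast
    obtain s where s: "s \<in> Arr C (cov X) (cov Y)" "Cmp C (cov X) (cov Y) Y (prj Y) s = s0"
      using projective[OF cov[OF X] Y cov_Ob[OF Y] prj_epi[OF Y] s0(1)] by blast
    \<comment> \<open>Composing with \<open>s\<close>, or with \<open>L X Y f\<close> below, does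
      not change the resulting map to \<open>X\<close>; the extra arrow \<open>a\<close> keeps both
      facts usable inside longer composites.\<close>
    have fs: "Cmp C A Y X f (Cmp C A (cov Y) Y (prj Y) (Cmp C A (cov X) (cov Y) s a)) = Cmp C A (cov X) X (prj X) a"
      if "A \<in> Ob C" "a \<in> Arr C A (cov X)" for A a
      using that * s s0 by (simp add: Cmp_assoc[OF C, symmetric])
    have fL: "Cmp C A Y X f (Cmp C A (cov Y) Y (prj Y) a) = Cmp C A (cov X) X (prj X) (Cmp C A (cov Y) (cov X) (L X Y f) a)"
      if "A \<in> Ob C" "a \<in> Arr C A (cov Y)" for A a
      using that * by (simp add: Cmp_assoc[OF C, symmetric])
    show ?thesis
      unfolding bij_betw_def
    proof (intro conjI inj_onI subset_antisym subsetI)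
      fix t t' assume "t \<in> Fob F X" "t' \<in> Fob F X" and eq: "Fmor F X Y f t = Fmor F X Y f t'"
      then have t: "t \<in> T X" "t' \<in> T X"
        using X by (simp_all add: F_simps)
      \<comment> \<open>\<open>L X Y f\<close> after \<open>s\<close> agrees with the identity of
        \<open>cov X\<close> over \<open>X\<close>, so the action of \<open>s\<close> undoes that of
        \<open>L X Y f\<close> on \<open>E X\<close>; injectivity follows.\<close>
      have "Fmor G (cov Y) (cov X) s (Fmor G (cov X) (cov Y) (L X Y f) (\<psi> X r)) = \<psi> X r" if r: "r \<in> T X" for r
      proof -
        have "Fmor G (cov X) (cov X) (Cmp C (cov X) (cov Y) (cov X) (L X Y f) s) (\<psi> X r) =
            Fmor G (cov X) (cov X) (Ide C (cov X)) (\<psi> X r)"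
          using * s r s0(2)
          by (intro E_eq \<psi>E) (simp_all add: Cmp_in_Arr[OF C] Ide_in_Arr[OF C] Cmp_Ide_right[OF C] flip: fL)
        then show ?thesis
          using * s \<psi>E[OF X r] by (simp add: GCmp GIde EG)
      qed
      then show "t = t'"
        using \<psi>_inj[OF X t] F_app(2)[OF X Y f t(1)] F_app(2)[OF X Y f t(2)] eq t by metis
    next
      fix r assume "r \<in> Fmor F X Y f ` Fob F X"
      then obtain t where t: "t \<in> T X" "r = Fmor F X Y f t"
        using X by (auto simp: F_simps)
      interpret F: presheaf C \<U> F
        using F_hat by unfold_locales
      show "r \<in> {y \<in> Fob F Y. Fmor F Y P p y = Fmor F Y P q y}"
        using * t pq by (simp add: F.Fmor_app F.Fmor_Cmp F_simps) (simp add: F_app)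
    next
      fix r assume "r \<in> {y \<in> Fob F Y. Fmor F Y P p y = Fmor F Y P q y}"
      then have r: "r \<in> T Y" and eq: "Fmor F Y P p r = Fmor F Y P q r"
        using Y by (simp_all add: F_simps)
      let ?z = "\<psi> Y r"
      have z: "?z \<in> E Y" "?z \<in> Fob G (cov Y)"
        using \<psi>E[OF Y r] EG by blast+
      \<comment> \<open>The core of descent: since \<open>r\<close> is equalised by \<open>p\<close>
        and \<open>q\<close>, its representative cannot distinguish arrows to \<open>cov Y\<close>
        that agree merely over \<open>X\<close>, whereas membership in \<open>E Y\<close> only
        covers agreement over \<open>Y\<close>.\<close>
      have glue: "Fmor G (cov Y) A a ?z = Fmor G (cov Y) A b ?z"
        if A: "A \<in> B" and a: "a \<in> Arr C A (cov Y)" and b: "b \<in> Arr C A (cov Y)"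
          and ab: "Cmp C A Y X f (Cmp C A (cov Y) Y (prj Y) a) = Cmp C A Y X f (Cmp C A (cov Y) Y (prj Y) b)" for A a b
      proof -
        note A' = A B_Ob[OF A]
        \<comment> \<open>The two arrows to \<open>Y\<close> agree over \<open>X\<close>, so they
          factor through the kernel pair; by projectivity of \<open>A\<close> the factorisation
          lifts to \<open>cov P\<close>.\<close>
        obtain u where u: "u \<in> Arr C A P" "Cmp C A P Y p u = Cmp C A (cov Y) Y (prj Y) a"
          "Cmp C A P Y q u = Cmp C A (cov Y) Y (prj Y) b"
          using univ[OF A'(2) _ _ ab] * a b A' by (auto simp: Cmp_in_Arr[OF C])
        obtain v where v: "v \<in> Arr C A (cov P)" "Cmp C A (cov P) P (prj P) v = u"
          using projective[OF A P cov_Ob[OF P] prj_epi[OF P] u(1)] by blast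
        \<comment> \<open>\<open>a\<close> and the composite of \<open>L Y P p\<close> with
          \<open>v\<close> lie over the same arrow into \<open>Y\<close>, so \<open>E_eq\<close>
          exchanges them; likewise for \<open>b\<close> and \<open>q\<close>.\<close>
        have "Fmor G (cov Y) A a ?z = Fmor G (cov Y) A (Cmp C A (cov P) (cov Y) (L Y P p) v) ?z"
          using * a v u A'
          by (intro E_eq z) (simp_all add: Cmp_in_Arr[OF C] flip: Cmp_assoc[OF C], simp add: Cmp_assoc[OF C])
        moreover have "Fmor G (cov Y) A b ?z = Fmor G (cov Y) A (Cmp C A (cov P) (cov Y) (L Y P q) v) ?z"
          using * b v u A'
          by (intro E_eq z) (simp_all add: Cmp_in_Arr[OF C] flip: Cmp_assoc[OF C], simp add: Cmp_assoc[OF C])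
        moreover have "Fmor G (cov Y) (cov P) (L Y P p) ?z = Fmor G (cov Y) (cov P) (L Y P q) ?z"
          using F_app(2)[OF Y P p r] F_app(2)[OF Y P q r] eq by simp
        ultimately show ?thesis
          using * v z A' by (simp flip: GCmp)
      qed
      \<comment> \<open>The candidate preimage is the restriction along \<open>s\<close>.\<close>
      let ?y = "Fmor G (cov Y) (cov X) s ?z"
      have y: "?y \<in> E X"
        unfolding E_def
      proof (intro CollectI conjI ballI impI)
        show "?y \<in> Fob G (cov X)"
          using * s z by (simp add: Gapp)
        fix A a a' assume A: "A \<in> B" "a \<in> Arr C A (cov X)" "a' \<in> Arr C A (cov X)"
          and "Cmp C A (cov X) X (prj X) a = Cmp C A (cov X) X (prj X) a'"
        then have "Fmor G (cov Y) A (Cmp C A (cov X) (cov Y) s a) ?z = Fmor G (cov Y) A (Cmp C A (cov X) (cov Y) s a') ?z"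
          using * s by (intro glue) (simp_all add: Cmp_in_Arr[OF C] B_Ob fs)
        then show "Fmor G (cov X) A a ?y = Fmor G (cov X) A a' ?y"
          using * s z A by (simp add: GCmp)
      qed
      \<comment> \<open>\<open>s\<close> after \<open>L X Y f\<close> agrees with the identity over
        \<open>X\<close> but perhaps not over \<open>Y\<close>, hence \<open>glue\<close> and not
        \<open>E_eq\<close>.\<close>
      have "Fmor G (cov Y) (cov Y) (Cmp C (cov Y) (cov X) (cov Y) s (L X Y f)) ?z = Fmor G (cov Y) (cov Y) (Ide C (cov Y)) ?z"
        using * s by (intro glue) (simp_all add: Cmp_in_Arr[OF C] Ide_in_Arr[OF C] fs Cmp_Ide_right[OF C])
      then have "Fmor G (cov X) (cov Y) (L X Y f) ?y = ?z"
        using * s z by (simp add: GCmp GIde)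
      then have "\<psi> Y (Fmor F X Y f (\<phi> X ?y)) = \<psi> Y r"
        using * y by (simp add: F_app \<phi>)
      then have "Fmor F X Y f (\<phi> X ?y) = r"
        by (rule \<psi>_inj[OF Y F_app(1)[OF X Y f \<phi>(1)[OF X y]] r])
      then show "r \<in> Fmor F X Y f ` Fob F X"
        using \<phi>(1)[OF X y] X by (intro image_eqI[of r _ "\<phi> X ?y"]) (simp_all add: F_simps)
    qed
  qed
  then have F_sheaf: "F \<in> sheaves"
    using F_hat by (simp add: sheaves_def)
  \<comment> \<open>An object of \<open>B\<close> is projective, so its cover splits.\<close>
  have "\<forall>X. \<exists>\<sigma>. X \<in> B \<longrightarrow> \<sigma> \<in> Arr C X (cov X) \<and> Cmp C X (cov X) X (prj X) \<sigma> = Ide C X"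
    using projective[OF _ B_Ob cov_Ob[OF B_Ob] prj_epi[OF B_Ob] Ide_in_Arr[OF C B_Ob]] by meson
  then obtain \<sigma> where \<sigma>: "\<And>X. X \<in> B \<Longrightarrow> \<sigma> X \<in> Arr C X (cov X)"
    "\<And>X. X \<in> B \<Longrightarrow> Cmp C X (cov X) X (prj X) (\<sigma> X) = Ide C X"
    by metis
  define \<epsilon> where "\<epsilon> = (\<lambda>X\<in>B. \<lambda>t\<in>T X. Fmor G (cov X) X (\<sigma> X) (\<psi> X t))"
  have "is_nat_trans (op_cat (full_subcat C B)) (Sets_cat \<U>) (Fob res F) G \<epsilon>"
  proof (rule nat_trans_SetsI)
    fix X assume "X \<in> Ob (op_cat (full_subcat C B))"
    then have X: "X \<in> B" "X \<in> Ob C"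
      using B_Ob by auto
    then show "\<epsilon> X \<in> Fob (Fob res F) X \<rightarrow>\<^sub>E Fob G X"
      using \<psi>E EG by (simp add: \<epsilon>_def F_simps Gapp cov \<sigma>)
  next
    fix X Y f t assume "X \<in> Ob (op_cat (full_subcat C B))" "Y \<in> Ob (op_cat (full_subcat C B))"
      "f \<in> Arr (op_cat (full_subcat C B)) X Y" "t \<in> Fob (Fob res F) X"
    then have XY: "X \<in> B" "X \<in> Ob C" "Y \<in> B" "Y \<in> Ob C" and f: "f \<in> Arr C Y X" and t: "t \<in> T X"
      using B_Ob by (auto simp: F_simps)
    note * = XY f t cov[OF XY(2)] cov_Ob[OF XY(2)] prj[OF XY(2)] cov[OF XY(4)] cov_Ob[OF XY(4)] prj[OF XY(4)]
      L[OF XY(2,4) f] \<sigma>(1)[OF XY(1)] \<sigma>(1)[OF XY(3)] \<psi>E[OF XY(2) t]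
    \<comment> \<open>Both ways round the naturality square lift \<open>f\<close> through
      \<open>prj X\<close>: the sections cancel the projections.\<close>
    have "Cmp C Y (cov X) X (prj X) (Cmp C Y (cov Y) (cov X) (L X Y f) (\<sigma> Y)) =
        Cmp C Y Y X f (Cmp C Y (cov Y) Y (prj Y) (\<sigma> Y))"
      using * by (simp flip: Cmp_assoc[OF C])
    also have "\<dots> = Cmp C Y (cov X) X (prj X) (Cmp C Y X (cov X) (\<sigma> X) f)"
      using * by (simp add: \<sigma> Cmp_Ide_left[OF C] Cmp_Ide_right[OF C] flip: Cmp_assoc[OF C])
    finally have "Fmor G (cov X) Y (Cmp C Y (cov Y) (cov X) (L X Y f) (\<sigma> Y)) (\<psi> X t) =
        Fmor G (cov X) Y (Cmp C Y X (cov X) (\<sigma> X) f) (\<psi> X t)"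
      using * by (intro E_eq) (simp_all add: Cmp_in_Arr[OF C])
    then show "\<epsilon> Y (Fmor (Fob res F) X Y f t) = Fmor G X Y f (\<epsilon> X t)"
      using * by (simp add: \<epsilon>_def F_app GCmp EG)
  qed
  then have \<epsilon>: "\<epsilon> \<in> Arr hatB (Fob res F) G"
    by (simp add: \<epsilon>_def)
  have "is_iso hatB (Fob res F) G \<epsilon>"
  proof (rule is_iso_presheafI[OF _ G \<epsilon>])
    show "Fob res F \<in> Ob hatB"
      unfolding res_simps by (rule restrict_functor_in_hatB[OF F_hat])
    fix X assume "X \<in> Ob (op_cat (full_subcat C B))"
    then have X: "X \<in> B" "X \<in> Ob C"
      using B_Ob by auto
    note * = X cov[OF X(2)] cov_Ob[OF X(2)] prj[OF X(2)] \<sigma>[OF X(1)] Ide_in_Arr[OF C X(2)]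
    \<comment> \<open>\<open>prj X\<close> is now an arrow of \<open>B\<close>, so functoriality of
      \<open>G\<close> makes elements restricted along it satisfy every test condition.\<close>
    have \<pi>E: "Fmor G X (cov X) (prj X) x \<in> E X" if "x \<in> Fob G X" for x
      unfolding E_def using * that by (auto simp: Gapp GCmp)
    show "bij_betw (\<epsilon> X) (Fob (Fob res F) X) (Fob G X)"
    \<comment> \<open>The inverse restricts along \<open>prj X\<close>. One composite is the
      identity since \<open>\<sigma> X\<close> is a section; the other because
      \<open>\<sigma> X\<close> after \<open>prj X\<close> agrees with the identity over
      \<open>X\<close>.\<close>
    proof (rule bij_betw_byWitness[where f' = "\<lambda>x. \<phi> X (Fmor G X (cov X) (prj X) x)"])
      show "\<forall>t\<in>Fob (Fob res F) X. \<phi> X (Fmor G X (cov X) (prj X) (\<epsilon> X t)) = t"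
      proof
        fix t assume "t \<in> Fob (Fob res F) X"
        then have t: "t \<in> T X"
          using X by (simp add: F_simps)
        have "Cmp C (cov X) (cov X) X (prj X) (Cmp C (cov X) X (cov X) (\<sigma> X) (prj X)) =
            Cmp C (cov X) (cov X) X (prj X) (Ide C (cov X))"
          using * by (simp add: Cmp_Ide_left[OF C] Cmp_Ide_right[OF C] flip: Cmp_assoc[OF C])
        then have "Fmor G (cov X) (cov X) (Cmp C (cov X) X (cov X) (\<sigma> X) (prj X)) (\<psi> X t) =
            Fmor G (cov X) (cov X) (Ide C (cov X)) (\<psi> X t)"
          using * t by (intro E_eq \<psi>E) (simp_all add: Cmp_in_Arr[OF C] Ide_in_Arr[OF C])
        then show "\<phi> X (Fmor G X (cov X) (prj X) (\<epsilon> X t)) = t"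
          using * t \<psi>E[OF X(2) t] by (simp add: \<epsilon>_def GCmp GIde EG \<phi>\<psi>)
      qed
      show "\<forall>x\<in>Fob G X. \<epsilon> X (\<phi> X (Fmor G X (cov X) (prj X) x)) = x"
        using * \<pi>E by (simp add: \<epsilon>_def \<phi> GCmp GIde)
      show "\<epsilon> X ` Fob (Fob res F) X \<subseteq> Fob G X"
        using presheaf_nat_app[OF \<epsilon>] X by auto
      show "(\<lambda>x. \<phi> X (Fmor G X (cov X) (prj X) x)) ` Fob G X \<subseteq> Fob (Fob res F) X"
        using * \<pi>E \<phi> by (auto simp: F_simps)
    qed
  qed
  then show ?thesis
    using F_sheaf by blast
qed

theorem res_is_equivalence: "is_equivalence (full_subcat hatC sheaves) hatB res"
proof (rule is_equivalenceI)
  have sub: "sheaves \<subseteq> Ob hatC"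
    by (auto simp: sheaves_def)
  show "is_category (full_subcat hatC sheaves)"
    by (intro is_category_full_subcat is_category_functor_cat is_category_Sets_cat sub)
  show "is_category hatB"
    by (intro is_category_functor_cat is_category_Sets_cat)
  show "is_functor (full_subcat hatC sheaves) hatB res"
    using is_functor_res sub unfolding is_functor_def full_subcat_simps by (meson subsetD)
  fix F G assume "F \<in> Ob (full_subcat hatC sheaves)" "G \<in> Ob (full_subcat hatC sheaves)"
  then have FG: "F \<in> Ob hatC" "G \<in> Ob hatC" "G \<in> sheaves"
    using sub by auto
  show "bij_betw (Fmor res F G) (Arr (full_subcat hatC sheaves) F G) (Arr hatB (Fob res F) (Fob res G))"
    unfolding bij_betw_def full_subcat_simps
  proof (intro conjI inj_onI subset_antisym subsetI)
    fix \<eta> \<theta> assume "\<eta> \<in> Arr hatC F G" "\<theta> \<in> Arr hatC F G" "Fmor res F G \<eta> = Fmor res F G \<theta>"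
    then show "\<eta> = \<theta>"
      using res_faithful[OF FG(1,3)] by simp
  next
    fix \<eta> assume "\<eta> \<in> Fmor res F G ` Arr hatC F G"
    then show "\<eta> \<in> Arr hatB (Fob res F) (Fob res G)"
      using restrict_nat_in_hatB[OF FG(1,2)] unfolding res_simps(2) by blast
  next
    fix \<eta> assume "\<eta> \<in> Arr hatB (Fob res F) (Fob res G)"
    then show "\<eta> \<in> Fmor res F G ` Arr hatC F G"
      using res_full[OF FG(1,3)] unfolding res_simps(2) by blast
  qed
next
  fix G assume "G \<in> Ob hatB"
  then show "\<exists>F\<in>Ob (full_subcat hatC sheaves). \<exists>\<epsilon>. is_iso hatB (Fob res F) G \<epsilon>"
    using res_ess_surj by simp
qed

end


section \<open>The space of ultrafilters\<close>

lemma ultrafilters_onD: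
  assumes "F \<in> ultrafilters_on S"
  shows "A \<in> F \<Longrightarrow> A \<subseteq> S" "S \<in> F" "{} \<notin> F" "A \<in> F \<Longrightarrow> B \<in> F \<Longrightarrow> A \<inter> B \<in> F"
    "A \<in> F \<Longrightarrow> A \<subseteq> B \<Longrightarrow> B \<subseteq> S \<Longrightarrow> B \<in> F" "A \<subseteq> S \<Longrightarrow> A \<notin> F \<Longrightarrow> S - A \<in> F"
proof -
  have *: "F \<subseteq> Pow S" "S \<in> F" "{} \<notin> F" "\<forall>A\<in>F. \<forall>B\<in>F. A \<inter> B \<in> F"
    "\<forall>A\<in>F. \<forall>B. A \<subseteq> B \<and> B \<subseteq> S \<longrightarrow> B \<in> F" "\<forall>A. A \<subseteq> S \<longrightarrow> A \<in> F \<or> S - A \<in> F"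
    using assms by (simp_all add: ultrafilters_on_def)
  show "S \<in> F" "{} \<notin> F"
    by (fact *)+
  show "A \<in> F \<Longrightarrow> A \<subseteq> S"
    using *(1) by blast
  show "A \<in> F \<Longrightarrow> B \<in> F \<Longrightarrow> A \<inter> B \<in> F"
    using *(4) by blast
  show "A \<in> F \<Longrightarrow> A \<subseteq> B \<Longrightarrow> B \<subseteq> S \<Longrightarrow> B \<in> F"
    using *(5) by blast
  show "A \<subseteq> S \<Longrightarrow> A \<notin> F \<Longrightarrow> S - A \<in> F"
    using *(6) by blast
qed

text \<open>Intersecting with \<open>S\<close> gives the empty family the value \<open>S\<close>,
  where a bare intersection would be the whole type.\<close>

lemma ultrafilters_on_Inter:
  assumes F: "F \<in> ultrafilters_on S" and "finite \<A>" "\<A> \<subseteq> F"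
  shows "S \<inter> \<Inter>\<A> \<in> F"
  using assms(2,3)
proof (induction rule: finite_induct)
  case empty
  then show ?case
    using ultrafilters_onD(2)[OF F] by simp
next
  case (insert A \<A>)
  then have "A \<inter> (S \<inter> \<Inter>\<A>) \<in> F"
    by (simp add: ultrafilters_onD(4)[OF F])
  then show ?case
    by (metis Inter_insert Int_left_commute)
qed

definition principal :: "'a set \<Rightarrow> 'a \<Rightarrow> 'a set set" where
  "principal S s = {A. A \<subseteq> S \<and> s \<in> A}"

lemma principal_ultrafilter: "s \<in> S \<Longrightarrow> principal S s \<in> ultrafilters_on S"
  by (auto simp: principal_def ultrafilters_on_def)

text \<open>The order dual of a proper filter. Ideals fit the compactness argument, where the sets
  handled by finite subfamilies of a cover form one directly.\<close>

definition proper_ideal :: "'a set \<Rightarrow> 'a set set \<Rightarrow> bool" where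
  "proper_ideal S I \<longleftrightarrow> I \<subseteq> Pow S \<and> {} \<in> I \<and> S \<notin> I \<and>
     (\<forall>A\<in>I. \<forall>B\<subseteq>A. B \<in> I) \<and> (\<forall>A\<in>I. \<forall>B\<in>I. A \<union> B \<in> I)"

lemma proper_idealI:
  assumes "\<And>A. A \<in> I \<Longrightarrow> A \<subseteq> S" "{} \<in> I" "S \<notin> I"
    "\<And>A B. A \<in> I \<Longrightarrow> B \<subseteq> A \<Longrightarrow> B \<in> I" "\<And>A B. A \<in> I \<Longrightarrow> B \<in> I \<Longrightarrow> A \<union> B \<in> I"
  shows "proper_ideal S I"
  using assms by (simp add: proper_ideal_def subset_iff)

lemma proper_idealD:
  assumes "proper_ideal S I"
  shows "A \<in> I \<Longrightarrow> A \<subseteq> S" "{} \<in> I" "S \<notin> I"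
    "A \<in> I \<Longrightarrow> B \<subseteq> A \<Longrightarrow> B \<in> I" "A \<in> I \<Longrightarrow> B \<in> I \<Longrightarrow> A \<union> B \<in> I"
  using assms by (auto simp: proper_ideal_def)

text \<open>Zorn's lemma enlarges the ideal to a maximal one; maximal ideals of \<open>Pow S\<close>
  are prime, and the complement of a prime ideal is an ultrafilter.\<close>

lemma ex_ultrafilter_disjoint_ideal:
  assumes I: "proper_ideal S I"
  shows "\<exists>F\<in>ultrafilters_on S. F \<inter> I = {}"
proof -
  let ?\<A> = "{J. proper_ideal S J \<and> I \<subseteq> J}"
  have "\<exists>M\<in>?\<A>. \<forall>J\<in>?\<A>. M \<subseteq> J \<longrightarrow> J = M"
  proof (rule subset_Zorn_nonempty)
    show "?\<A> \<noteq> {}"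
      using I by blast
    fix \<C> assume "\<C> \<noteq> {}" and ch: "subset.chain ?\<A> \<C>"
    then have sub: "\<And>J. J \<in> \<C> \<Longrightarrow> proper_ideal S J \<and> I \<subseteq> J"
      by (auto simp: subset_chain_def)
    have Un: "A \<union> B \<in> \<Union>\<C>" if AB: "A \<in> \<Union>\<C>" "B \<in> \<Union>\<C>" for A B
    proof -
      obtain J K where JK: "A \<in> J" "J \<in> \<C>" "B \<in> K" "K \<in> \<C>"
        using AB by blast
      then have "J \<subseteq> K \<or> K \<subseteq> J"
        using ch by (auto simp: subset_chain_def)
      then obtain L where "L \<in> \<C>" "A \<in> L" "B \<in> L"
        using JK by blast
      then show ?thesis
        using sub[of L] proper_idealD(5) by blast
    qed
    have "proper_ideal S (\<Union>\<C>)"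
    proof (rule proper_idealI[OF _ _ _ _ Un])
      show "{} \<in> \<Union>\<C>"
        using sub \<open>\<C> \<noteq> {}\<close> proper_idealD(2) by blast
      show "S \<notin> \<Union>\<C>"
        using sub proper_idealD(3) by blast
      show "A \<subseteq> S" if "A \<in> \<Union>\<C>" for A
        using that sub proper_idealD(1) by blast
      show "B \<in> \<Union>\<C>" if "A \<in> \<Union>\<C>" "B \<subseteq> A" for A B
        using that sub proper_idealD(4) by blast
    qed
    then show "\<Union>\<C> \<in> ?\<A>"
      using sub \<open>\<C> \<noteq> {}\<close> by blast
  qed
  then obtain M where M: "proper_ideal S M" "I \<subseteq> M"
    and max: "\<And>J. proper_ideal S J \<Longrightarrow> M \<subseteq> J \<Longrightarrow> J = M"
    by (smt (verit, best) mem_Collect_eq subset_trans)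
  note Msub = proper_idealD(1)[OF M(1)] and Me = proper_idealD(2)[OF M(1)] and MS = proper_idealD(3)[OF M(1)]
    and Md = proper_idealD(4)[OF M(1)] and Mu = proper_idealD(5)[OF M(1)]
  have prime: "A \<in> M \<or> S - A \<in> M" if A: "A \<subseteq> S" for A
  proof (rule disjCI)
    assume nS: "S - A \<notin> M"
    \<comment> \<open>The ideal generated by \<open>M\<close> and \<open>A\<close>. It is proper
      since \<open>S - A\<close> is not in \<open>M\<close>, so maximality puts \<open>A\<close>
      into \<open>M\<close>.\<close>
    let ?J = "{B. B \<subseteq> S \<and> (\<exists>m\<in>M. B \<subseteq> m \<union> A)}"
    have "proper_ideal S ?J"
    proof (rule proper_idealI)
      show "{} \<in> ?J"
        using Me by blast
      show "S \<notin> ?J"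
      proof
        assume "S \<in> ?J"
        then obtain m where "m \<in> M" "S \<subseteq> m \<union> A"
          by blast
        then have "S - A \<in> M"
          using Md[of m "S - A"] by blast
        then show False
          using nS by simp
      qed
      fix B C assume "B \<in> ?J" "C \<in> ?J"
      then obtain m n where "m \<in> M" "n \<in> M" "B \<subseteq> m \<union> A" "C \<subseteq> n \<union> A" "B \<subseteq> S" "C \<subseteq> S"
        by blast
      then show "B \<union> C \<in> ?J"
        using Mu[of m n] by blast
    next
      fix B assume "B \<in> ?J"
      then show "B \<subseteq> S"
        by blast
      fix C assume "C \<subseteq> B"
      then show "C \<in> ?J"
        using \<open>B \<in> ?J\<close> by blast
    qed
    moreover have "M \<subseteq> ?J"
      using Msub by fast
    ultimately have "?J = M"
      by (rule max)
    moreover have "A \<in> ?J"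
      using A Me by blast
    ultimately show "A \<in> M"
      by simp
  qed
  \<comment> \<open>Otherwise the two complements lie in \<open>M\<close>, and together with the
    intersection they cover \<open>S\<close>.\<close>
  have Int: "A \<inter> B \<notin> M" if "A \<subseteq> S" "B \<subseteq> S" "A \<notin> M" "B \<notin> M" for A B
  proof
    assume "A \<inter> B \<in> M"
    moreover have "(S - A) \<union> (S - B) \<in> M"
      using prime that by (intro Mu) blast+
    ultimately have "(A \<inter> B) \<union> ((S - A) \<union> (S - B)) \<in> M"
      by (rule Mu)
    moreover have "(A \<inter> B) \<union> ((S - A) \<union> (S - B)) = S"
      using that by blast
    ultimately show False
      using MS by simp
  qed
  have compl: "S - A \<notin> M" if "A \<in> M" for A
  proof
    assume "S - A \<in> M"
    then have "A \<union> (S - A) \<in> M"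
      by (rule Mu[OF that])
    moreover have "A \<union> (S - A) = S"
      using Msub[OF that] by blast
    ultimately show False
      using MS by simp
  qed
  have "Pow S - M \<in> ultrafilters_on S"
    unfolding ultrafilters_on_def
  proof (intro CollectI conjI ballI allI impI)
    show "A \<inter> B \<in> Pow S - M" if "A \<in> Pow S - M" "B \<in> Pow S - M" for A B
      using that Int[of A B] by blast
    show "B \<in> Pow S - M" if "A \<in> Pow S - M" "A \<subseteq> B \<and> B \<subseteq> S" for A B
      using that Md[of B A] by blast
    show "A \<in> Pow S - M \<or> S - A \<in> Pow S - M" if "A \<subseteq> S" for A
      using that compl by blast
  qed (use Me MS in auto)
  then show ?thesis
    using M(2) by blast
qed

section \<open>The topology on ultrafilters: base, compactness, separation\<close>

lemma openin_ultrafilter_space_basic: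
  "A \<subseteq> S \<Longrightarrow> openin (ultrafilter_space S) {F \<in> ultrafilters_on S. A \<in> F}"
  unfolding ultrafilter_space_def by (rule topology_generated_by_Basis) blast

text \<open>The generating sets already form a base, since an ultrafilter contains two subsets of
  \<open>S\<close> exactly when it contains their intersection. The induction runs over the
  generation of the topology.\<close>

lemma openin_ultrafilter_space_nhd:
  assumes "openin (ultrafilter_space S) W" "F \<in> W"
  shows "\<exists>A\<in>F. {G \<in> ultrafilters_on S. A \<in> G} \<subseteq> W"
proof -
  have top: "F \<in> ultrafilters_on S"
    using assms openin_subset topspace_ultrafilter_space by blast
  have "generate_topology_on ((\<lambda>A. {F \<in> ultrafilters_on S. A \<in> F}) ` Pow S) W"
    using assms by (simp add: ultrafilter_space_def openin_topology_generated_by)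
  then show ?thesis
    using assms(2)
  proof (induction)
    case (Int V W)
    then obtain A B where AB: "A \<in> F" "B \<in> F" "{G \<in> ultrafilters_on S. A \<in> G} \<subseteq> V" "{G \<in> ultrafilters_on S. B \<in> G} \<subseteq> W"
      by blast
    have "A \<inter> B \<in> F"
      using top AB by (simp add: ultrafilters_onD(4))
    moreover have "A \<in> G" "B \<in> G" if "G \<in> ultrafilters_on S" "A \<inter> B \<in> G" for G
      using that AB(1,2) ultrafilters_onD(1)[OF top] ultrafilters_onD(5)[OF that] by auto
    ultimately show ?case
      using AB by blast
  next
    case (UN K)
    then obtain k where "k \<in> K" "F \<in> k"
      by blast
    with UN(2)[OF this] show ?case
      by blast
  qed auto
qed

lemma compact_space_ultrafilter_space: "compact_space (ultrafilter_space S)"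
  unfolding compact_space topspace_ultrafilter_space
proof (intro allI impI)
  fix \<U> assume \<U>: "(\<forall>U\<in>\<U>. openin (ultrafilter_space S) U) \<and> \<Union>\<U> = ultrafilters_on S"
  \<comment> \<open>The subsets whose basic open set is covered by finitely many members of the
    cover. The goal is that \<open>S\<close> is one of them.\<close>
  define I where "I = {A. A \<subseteq> S \<and> (\<exists>\<F>. finite \<F> \<and> \<F> \<subseteq> \<U> \<and> {F \<in> ultrafilters_on S. A \<in> F} \<subseteq> \<Union>\<F>)}"
  have II: "A \<in> I" if "A \<subseteq> S" "finite \<F>" "\<F> \<subseteq> \<U>" "{F \<in> ultrafilters_on S. A \<in> F} \<subseteq> \<Union>\<F>" for A \<F>
    unfolding I_def using that by (intro CollectI conjI exI[of _ \<F>])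
  have IE: "\<exists>\<F>. finite \<F> \<and> \<F> \<subseteq> \<U> \<and> {F \<in> ultrafilters_on S. A \<in> F} \<subseteq> \<Union>\<F>" "A \<subseteq> S" if "A \<in> I" for A
    using that by (simp_all add: I_def)
  have "S \<in> I"
  proof (rule ccontr)
    assume "S \<notin> I"
    have "proper_ideal S I"
    proof (rule proper_idealI)
      show "{} \<in> I"
        using ultrafilters_onD(3)[of _ S] by (auto simp: I_def intro!: exI[of _ "{}"])
      fix A B assume A: "A \<in> I" and B: "B \<subseteq> A"
      then have "{F \<in> ultrafilters_on S. B \<in> F} \<subseteq> {F \<in> ultrafilters_on S. A \<in> F}"
        using ultrafilters_onD(5)[of _ S B A] by (auto simp: I_def)
      moreover obtain \<F> where "finite \<F>" "\<F> \<subseteq> \<U>" "{F \<in> ultrafilters_on S. A \<in> F} \<subseteq> \<Union>\<F>"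
        using IE(1)[OF A] by (elim exE conjE)
      ultimately show "B \<in> I"
        using B IE(2)[OF A] by (intro II[of B \<F>]) (auto dest: subset_trans)
    next
      fix A B assume AB: "A \<in> I" "B \<in> I"
      obtain \<F> \<G> where *: "finite \<F>" "\<F> \<subseteq> \<U>" "{F \<in> ultrafilters_on S. A \<in> F} \<subseteq> \<Union>\<F>"
        "finite \<G>" "\<G> \<subseteq> \<U>" "{F \<in> ultrafilters_on S. B \<in> F} \<subseteq> \<Union>\<G>" "A \<subseteq> S" "B \<subseteq> S"
        using IE(1)[OF AB(1)] IE(1)[OF AB(2)] IE(2)[OF AB(1)] IE(2)[OF AB(2)] by (elim exE conjE)
      \<comment> \<open>Ultrafilters are prime, so the basic open set of a union lies in the union
        of the basic open sets, and the two finite subfamilies can be joined.\<close>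
      have "A \<in> F \<or> B \<in> F" if F: "F \<in> ultrafilters_on S" "A \<union> B \<in> F" for F
      proof (rule ccontr)
        assume "\<not> (A \<in> F \<or> B \<in> F)"
        then have "(A \<union> B) \<inter> ((S - A) \<inter> (S - B)) \<in> F"
          using F * by (intro ultrafilters_onD(4)[OF F(1)] ultrafilters_onD(6)[OF F(1)]) auto
        moreover have "(A \<union> B) \<inter> ((S - A) \<inter> (S - B)) = {}"
          by blast
        ultimately show False
          using ultrafilters_onD(3)[OF F(1)] by simp
      qed
      then have "{F \<in> ultrafilters_on S. A \<union> B \<in> F} \<subseteq> \<Union>(\<F> \<union> \<G>)"
        using * by blast
      moreover have "finite (\<F> \<union> \<G>)" "\<F> \<union> \<G> \<subseteq> \<U>" "A \<union> B \<subseteq> S"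
        using * by auto
      ultimately show "A \<union> B \<in> I"
        by (intro II[of _ "\<F> \<union> \<G>"])
    qed (use \<open>S \<notin> I\<close> in \<open>auto simp: I_def\<close>)
    \<comment> \<open>Some member of the cover contains this ultrafilter, and with it the basic open
      set of one of its elements; that element then lies in \<open>I\<close>, a
      contradiction.\<close>
    then obtain F where F: "F \<in> ultrafilters_on S" "F \<inter> I = {}"
      using ex_ultrafilter_disjoint_ideal by blast
    then obtain U where U: "U \<in> \<U>" "F \<in> U" "openin (ultrafilter_space S) U"
      using \<U> by blast
    then obtain A where A: "A \<in> F" "{G \<in> ultrafilters_on S. A \<in> G} \<subseteq> U"
      using openin_ultrafilter_space_nhd by blast
    have "A \<in> I"
      using A U by (intro II[of A "{U}"] ultrafilters_onD(1)[OF F(1)]) auto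
    then show False
      using A F by blast
  qed
  then obtain \<F> where "finite \<F>" "\<F> \<subseteq> \<U>" "{F \<in> ultrafilters_on S. S \<in> F} \<subseteq> \<Union>\<F>"
    using IE(1)[of S] by auto
  moreover have "{F \<in> ultrafilters_on S. S \<in> F} = ultrafilters_on S"
    using ultrafilters_onD(2) by blast
  ultimately show "\<exists>\<F>. finite \<F> \<and> \<F> \<subseteq> \<U> \<and> \<Union>\<F> = ultrafilters_on S"
    using \<U> by (intro exI[of _ \<F>]) blast
qed

lemma Hausdorff_space_ultrafilter_space: "Hausdorff_space (ultrafilter_space S)"
  unfolding Hausdorff_space_def topspace_ultrafilter_space
proof (intro allI impI)
  fix F G assume "F \<in> ultrafilters_on S \<and> G \<in> ultrafilters_on S \<and> F \<noteq> G"
  then have F: "F \<in> ultrafilters_on S" and G: "G \<in> ultrafilters_on S" and "F \<noteq> G"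
    by auto
  \<comment> \<open>Ultrafilters are maximal: a proper inclusion would put a set and its complement
    into the larger one.\<close>
  have "\<exists>A\<in>F. A \<notin> G"
  proof (rule ccontr)
    assume "\<not> (\<exists>A\<in>F. A \<notin> G)"
    then have "F \<subset> G"
      using \<open>F \<noteq> G\<close> by blast
    then obtain A where A: "A \<in> G" "A \<notin> F"
      by blast
    have "S - A \<in> F"
      by (rule ultrafilters_onD(6)[OF F ultrafilters_onD(1)[OF G A(1)] A(2)])
    then have "A \<inter> (S - A) \<in> G"
      using \<open>F \<subset> G\<close> by (intro ultrafilters_onD(4)[OF G A(1)]) auto
    then show False
      using ultrafilters_onD(3)[OF G] by simp
  qed
  then obtain A where A: "A \<in> F" "S - A \<in> G" "A \<subseteq> S"
    using ultrafilters_onD(1)[OF F] ultrafilters_onD(6)[OF G] by metis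
  have "disjnt {F \<in> ultrafilters_on S. A \<in> F} {F \<in> ultrafilters_on S. S - A \<in> F}"
    using ultrafilters_onD(3)[of _ S] ultrafilters_onD(4)[of _ S A "S - A"] by (auto simp: disjnt_iff)
  then show "\<exists>U V. openin (ultrafilter_space S) U \<and> openin (ultrafilter_space S) V \<and> F \<in> U \<and> G \<in> V \<and> disjnt U V"
    using A F G openin_ultrafilter_space_basic[of A S] openin_ultrafilter_space_basic[of "S - A" S]
    by (intro exI conjI) auto
qed

section \<open>Limits along an ultrafilter and the universal property of the ultrafilter
  space\<close>

definition converges_along :: "'a set set \<Rightarrow> 'a set \<Rightarrow> 'b topology \<Rightarrow> ('a \<Rightarrow> 'b) \<Rightarrow> 'b \<Rightarrow> bool" where
  "converges_along F S X h x \<longleftrightarrow> x \<in> topspace X \<and> (\<forall>V. openin X V \<longrightarrow> x \<in> V \<longrightarrow> {s \<in> S. h s \<in> V} \<in> F)"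

lemma converges_along_unique:
  assumes F: "F \<in> ultrafilters_on S" and X: "Hausdorff_space X"
    and x: "converges_along F S X h x" and y: "converges_along F S X h y"
  shows "x = y"
proof (rule ccontr)
  assume "x \<noteq> y"
  then obtain U V where UV: "openin X U" "openin X V" "x \<in> U" "y \<in> V" "disjnt U V"
    using X x y unfolding Hausdorff_space_def converges_along_def by metis
  then have "{s \<in> S. h s \<in> U} \<inter> {s \<in> S. h s \<in> V} \<in> F"
    using x y by (intro ultrafilters_onD(4)[OF F]) (auto simp: converges_along_def)
  moreover have "{s \<in> S. h s \<in> U} \<inter> {s \<in> S. h s \<in> V} = {}"
    using UV(5) by (auto simp: disjnt_iff)
  ultimately show False
    using ultrafilters_onD(3)[OF F] by simp
qed

text \<open>Without a limit every point has an open neighbourhood whose preimage is not in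
  \<open>F\<close>. Finitely many of these cover \<open>X\<close>, and the complements of their
  preimages lie in \<open>F\<close> with empty intersection.\<close>

lemma converges_along_ex:
  assumes F: "F \<in> ultrafilters_on S" and X: "compact_space X" and h: "h \<in> S \<rightarrow> topspace X"
  shows "\<exists>x. converges_along F S X h x"
proof (rule ccontr)
  assume no: "\<nexists>x. converges_along F S X h x"
  let ?\<V> = "{V. openin X V \<and> {s \<in> S. h s \<in> V} \<notin> F}"
  have "\<exists>V\<in>?\<V>. x \<in> V" if "x \<in> topspace X" for x
    using no that unfolding converges_along_def by blast
  then have "topspace X = \<Union>?\<V>"
    using openin_subset by blast
  then obtain \<F> where \<F>: "finite \<F>" "\<F> \<subseteq> ?\<V>" "\<Union>\<F> = topspace X"
    using X unfolding compact_space by (metis (no_types, lifting) mem_Collect_eq)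
  let ?\<A> = "(\<lambda>V. S - {s \<in> S. h s \<in> V}) ` \<F>"
  have "?\<A> \<subseteq> F"
    using \<F>(2) by (auto intro!: ultrafilters_onD(6)[OF F])
  then have "S \<inter> \<Inter>?\<A> \<in> F"
    using \<F>(1) by (intro ultrafilters_on_Inter[OF F]) auto
  moreover have "S \<inter> \<Inter>?\<A> = {}"
    using \<F>(3) h by auto
  ultimately show False
    using ultrafilters_onD(3)[OF F] by simp
qed

lemma converges_along_principal:
  assumes "h s \<in> topspace X" "s \<in> S"
  shows "converges_along (principal S s) S X h (h s)"
  using assms by (auto simp: converges_along_def principal_def)

text \<open>Every ultrafilter is the limit, along itself, of the principal ultrafilters, and
  continuity carries this over to \<open>g\<close>. In a Hausdorff target this determines
  \<open>g\<close> from its values on principal ultrafilters.\<close>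

lemma converges_along_continuous:
  assumes g: "continuous_map (ultrafilter_space S) X g" and F: "F \<in> ultrafilters_on S"
  shows "converges_along F S X (\<lambda>s. g (principal S s)) (g F)"
  unfolding converges_along_def
proof (intro conjI allI impI)
  show "g F \<in> topspace X"
    using g F by (auto simp: continuous_map_def topspace_ultrafilter_space)
  fix V assume V: "openin X V" "g F \<in> V"
  have "openin (ultrafilter_space S) {G \<in> ultrafilters_on S. g G \<in> V}"
    using openin_continuous_map_preimage[OF g V(1)] by (simp add: topspace_ultrafilter_space)
  then obtain A where A: "A \<in> F" "{G \<in> ultrafilters_on S. A \<in> G} \<subseteq> {G \<in> ultrafilters_on S. g G \<in> V}"
    using openin_ultrafilter_space_nhd[of S _ F] F V(2) by blast
  have "A \<subseteq> {s \<in> S. g (principal S s) \<in> V}"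
  proof
    fix s assume s: "s \<in> A"
    then have "s \<in> S" "A \<subseteq> S"
      using A(1) ultrafilters_onD(1)[OF F] by auto
    then have "principal S s \<in> {G \<in> ultrafilters_on S. A \<in> G}"
      using s principal_ultrafilter by (auto simp: principal_def)
    then show "s \<in> {s \<in> S. g (principal S s) \<in> V}"
      using A(2) \<open>s \<in> S\<close> by blast
  qed
  then show "{s \<in> S. g (principal S s) \<in> V} \<in> F"
    using ultrafilters_onD(5)[OF F A(1)] by blast
qed

text \<open>The extension sends an ultrafilter to the limit of \<open>h\<close> along it, which
  exists by compactness and is unique by the Hausdorff property.\<close>

lemma ultrafilter_space_extension:
  assumes X: "compact_space X" "Hausdorff_space X" and h: "h \<in> S \<rightarrow> topspace X"
  shows "\<exists>g. continuous_map (ultrafilter_space S) X g \<and> (\<forall>s\<in>S. g (principal S s) = h s)"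
proof -
  define g where "g F = (SOME x. converges_along F S X h x)" for F
  have g: "converges_along F S X h (g F)" if "F \<in> ultrafilters_on S" for F
    unfolding g_def using converges_along_ex[OF that X(1) h] by (rule someI_ex)
  have "continuous_map (ultrafilter_space S) X g"
    unfolding continuous_map_def
  proof (intro conjI allI impI)
    show "g \<in> topspace (ultrafilter_space S) \<rightarrow> topspace X"
      using g by (auto simp: topspace_ultrafilter_space converges_along_def)
    fix V assume V: "openin X V"
    show "openin (ultrafilter_space S) {F \<in> topspace (ultrafilter_space S). g F \<in> V}"
      unfolding topspace_ultrafilter_space
    proof (subst openin_subopen, intro ballI)
      fix F assume "F \<in> {F \<in> ultrafilters_on S. g F \<in> V}"
      then have F: "F \<in> ultrafilters_on S" "g F \<in> V"
        by auto
      \<comment> \<open>Regularity supplies a closed \<open>K\<close> between a neighbourhood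
        \<open>U\<close> and \<open>V\<close>. An ultrafilter containing the preimage of
        \<open>U\<close> has its limit in \<open>K\<close>, since otherwise it would also contain
        the disjoint preimage of the complement of \<open>K\<close>.\<close>
      have "neighbourhood_base_of (closedin X) X"
        using compact_Hausdorff_imp_regular_space[OF X] by (simp add: neighbourhood_base_of_closedin)
      then obtain U K where UK: "openin X U" "closedin X K" "g F \<in> U" "U \<subseteq> K" "K \<subseteq> V"
        using V F(2) unfolding neighbourhood_base_of by meson
      let ?A = "{s \<in> S. h s \<in> U}"
      have A: "?A \<in> F"
        using g[OF F(1)] UK by (auto simp: converges_along_def)
      have "g G \<in> V" if G: "G \<in> ultrafilters_on S" "?A \<in> G" for G
      proof (rule ccontr)
        assume "g G \<notin> V"
        then have "g G \<in> topspace X - K" "openin X (topspace X - K)"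
          using g[OF G(1)] UK by (auto simp: converges_along_def)
        then have "{s \<in> S. h s \<in> topspace X - K} \<in> G"
          using g[OF G(1)] by (auto simp: converges_along_def)
        then have "?A \<inter> {s \<in> S. h s \<in> topspace X - K} \<in> G"
          using G by (simp only: ultrafilters_onD(4)[OF G(1)])
        moreover have "?A \<inter> {s \<in> S. h s \<in> topspace X - K} = {}"
          using UK by auto
        ultimately show False
          using ultrafilters_onD(3)[OF G(1)] by simp
      qed
      then show "\<exists>T. openin (ultrafilter_space S) T \<and> F \<in> T \<and> T \<subseteq> {F \<in> ultrafilters_on S. g F \<in> V}"
        using F A by (intro exI[of _ "{G \<in> ultrafilters_on S. ?A \<in> G}"])
          (auto intro: openin_ultrafilter_space_basic)
    qed
  qed
  moreover have "g (principal S s) = h s" if "s \<in> S" for s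
    using converges_along_unique[OF principal_ultrafilter[OF that] X(2) g converges_along_principal]
      principal_ultrafilter[OF that] that h by blast
  ultimately show ?thesis
    by blast
qed

lemma ultrafilter_space_map_eq:
  assumes X: "Hausdorff_space X"
    and g: "continuous_map (ultrafilter_space S) X g" and g': "continuous_map (ultrafilter_space S) X g'"
    and eq: "\<And>s. s \<in> S \<Longrightarrow> g (principal S s) = g' (principal S s)"
    and F: "F \<in> ultrafilters_on S"
  shows "g F = g' F"
proof (rule converges_along_unique[OF F X])
  show "converges_along F S X (\<lambda>s. g (principal S s)) (g F)"
    by (rule converges_along_continuous[OF g F])
  have "{s \<in> S. g (principal S s) \<in> V} = {s \<in> S. g' (principal S s) \<in> V}" for V
    using eq by auto
  then show "converges_along F S X (\<lambda>s. g (principal S s)) (g' F)"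
    using converges_along_continuous[OF g' F] by (simp add: converges_along_def)
qed

text \<open>On principal ultrafilters a lift is a free choice of preimages under the surjection
  \<open>f\<close>. It extends by the universal property, and the two maps to \<open>X\<close> agree
  everywhere because they agree there.\<close>

lemma ultrafilter_space_projective:
  assumes X: "Hausdorff_space X" and Y: "compact_space Y" "Hausdorff_space Y"
    and f: "continuous_map Y X f" "f ` topspace Y = topspace X"
    and g: "continuous_map (ultrafilter_space S) X g"
  shows "\<exists>h. continuous_map (ultrafilter_space S) Y h \<and> (\<forall>F\<in>ultrafilters_on S. f (h F) = g F)"
proof -
  have gX: "g (principal S s) \<in> f ` topspace Y" if "s \<in> S" for s
    using g principal_ultrafilter[OF that] f(2) by (auto simp: continuous_map_def topspace_ultrafilter_space)
  let ?k = "\<lambda>s. inv_into (topspace Y) f (g (principal S s))"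
  have k: "?k \<in> S \<rightarrow> topspace Y"
    using gX by (auto intro: inv_into_into)
  then obtain h where h: "continuous_map (ultrafilter_space S) Y h" "\<And>s. s \<in> S \<Longrightarrow> h (principal S s) = ?k s"
    using ultrafilter_space_extension[OF Y k] by blast
  have "f (h F) = g F" if F: "F \<in> ultrafilters_on S" for F
    using ultrafilter_space_map_eq[OF X continuous_map_compose[OF h(1) f(1)] g _ F] h(2) gX
    by (simp add: f_inv_into_f)
  then show ?thesis
    using h(1) by blast
qed


section \<open>Compact Hausdorff spaces\<close>

lemma set_universe_lepoll:
  assumes U: "set_universe \<U>" and S: "S \<in> \<U>" and A: "A \<lesssim> Pow S"
  shows "\<exists>T\<in>\<U>. T \<approx> A"
proof -
  obtain f where f: "inj_on f A" "f ` A \<subseteq> Pow S"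
    using A unfolding lepoll_def by blast
  then obtain T where "T \<in> \<U>" "T \<approx> f ` A"
    using U S unfolding set_universe_def by blast
  moreover have "f ` A \<approx> A"
    by (rule inj_on_image_eqpoll_self[OF f(1)])
  ultimately show ?thesis
    using eqpoll_trans by blast
qed

lemma lepoll_Pow_self: "A \<subseteq> S \<Longrightarrow> A \<lesssim> Pow S"
  unfolding lepoll_def by (intro exI[of _ "\<lambda>x. {x}"]) auto

lemma set_universe_subset:
  "set_universe \<U> \<Longrightarrow> S \<in> \<U> \<Longrightarrow> A \<subseteq> S \<Longrightarrow> \<exists>T\<in>\<U>. T \<approx> A"
  by (intro set_universe_lepoll lepoll_Pow_self)

text \<open>Kuratowski pairs embed the square of \<open>S\<close> into a double power set. The inner
  power set is replaced by its copy \<open>P\<close> in \<U> via \<open>k\<close>, so that pairs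
  become subsets of \<open>P\<close>.\<close>

lemma set_universe_Times:
  assumes U: "set_universe \<U>" and S: "S \<in> \<U>" and A: "A \<subseteq> S \<times> S"
  shows "\<exists>T\<in>\<U>. T \<approx> A"
proof -
  obtain P where P: "P \<in> \<U>" "P \<approx> Pow S"
    using U S unfolding set_universe_def by blast
  then obtain k where k: "bij_betw k (Pow S) P"
    using eqpoll_sym unfolding eqpoll_def by blast
  have k_inj: "k B = k C \<longleftrightarrow> B = C" if "B \<subseteq> S" "C \<subseteq> S" for B C
    using k that by (auto simp: bij_betw_def inj_on_eq_iff)
  have "inj_on (\<lambda>(x, y). {k {x}, k {x, y}}) (S \<times> S)"
    by (rule inj_onI) (auto simp: doubleton_eq_iff k_inj)
  then have "inj_on (\<lambda>(x, y). {k {x}, k {x, y}}) A"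
    using A by (rule inj_on_subset)
  moreover have "(\<lambda>(x, y). {k {x}, k {x, y}}) ` A \<subseteq> Pow P"
    using A bij_betwE[OF k] by auto
  ultimately show ?thesis
    by (intro set_universe_lepoll[OF U P(1)]) (auto simp: lepoll_def)
qed

section \<open>The category of compact Hausdorff spaces: epimorphisms and kernel pairs\<close>

lemma CHaus_simps [simp]:
  "X \<in> Ob (CHaus \<U>) \<longleftrightarrow> compact_space X \<and> Hausdorff_space X \<and> topspace X \<in> \<U>"
  "f \<in> Arr (CHaus \<U>) X Y \<longleftrightarrow> f \<in> extensional (topspace X) \<and> continuous_map X Y f"
  "Ide (CHaus \<U>) X = (\<lambda>x\<in>topspace X. x)"
  "Cmp (CHaus \<U>) X Y Z g f = compose (topspace X) g f"
  by (auto simp: CHaus_def)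

lemma continuous_map_app: "continuous_map X Y f \<Longrightarrow> x \<in> topspace X \<Longrightarrow> f x \<in> topspace Y"
  by (auto simp: continuous_map_def)

lemma compose_eq_iff:
  "compose A g f = compose A g' f' \<longleftrightarrow> (\<forall>x\<in>A. g (f x) = g' (f' x))"
  by (auto simp: compose_def fun_eq_iff)

lemma compose_eq_iff':
  "h \<in> extensional A \<Longrightarrow> compose A g f = h \<longleftrightarrow> (\<forall>x\<in>A. g (f x) = h x)"
  by (auto simp: compose_def fun_eq_iff extensional_def)

lemma continuous_map_compose_on:
  "continuous_map X Y f \<Longrightarrow> continuous_map Y Z g \<Longrightarrow> continuous_map X Z (compose (topspace X) g f)"
  using continuous_map_compose[of X Y f Z g] by (simp add: compose_def o_def)

lemma is_category_CHaus: "is_category (CHaus \<U>)"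
  unfolding is_category_def
  by (auto simp: continuous_map_compose_on compose_eq_iff compose_eq_iff' continuous_map_app[rotated]
      dest: continuous_map_app) (auto simp: compose_def continuous_map_app)

text \<open>Products and compactifications leave the type of points; pulling the topology back along
  a bijection with a member of \<U> returns them to the category.\<close>

lemma CHaus_copy:
  assumes U: "set_universe \<U>" and Z: "compact_space Z" "Hausdorff_space Z" and T: "T \<in> \<U>" "T \<approx> topspace Z"
  shows "\<exists>X\<in>Ob (CHaus \<U>). X homeomorphic_space Z"
proof -
  obtain g where "bij_betw g T (topspace Z)"
    using T(2) unfolding eqpoll_def by blast
  then obtain X where X: "topspace X = T" "X homeomorphic_space Z"
    using homeomorphic_copy by blast
  then have "compact_space X" "Hausdorff_space X"
    using Z homeomorphic_compact_space homeomorphic_Hausdorff_space by blast+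
  then show ?thesis
    using X T(1) by auto
qed

text \<open>A map onto a proper closed subset \<open>K\<close> is not epi: collapsing \<open>K\<close> to a point, realised as the
  point at infinity of the one-point compactification of \<open>X - K\<close>, agrees on \<open>K\<close> with a constant map.\<close>

lemma CHaus_epi_imp_surj:
  assumes U: "set_universe \<U>" and X: "X \<in> Ob (CHaus \<U>)" and Y: "Y \<in> Ob (CHaus \<U>)"
    and f: "is_epi (CHaus \<U>) Y X f"
  shows "f ` topspace Y = topspace X"
proof (rule ccontr)
  assume ne: "f ` topspace Y \<noteq> topspace X"
  have fc: "continuous_map Y X f"
    using f by (simp add: is_epi_def)
  define K where "K = f ` topspace Y"
  have Ksub: "K \<subseteq> topspace X"
    using fc by (auto simp: K_def continuous_map_app)
  have cX: "compact_space X" "Hausdorff_space X" and XU: "topspace X \<in> \<U>"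
    using X by auto
  have "compactin X K"
    unfolding K_def using Y fc by (intro image_compactin[of Y]) (simp_all add: compact_space_def)
  then have K: "closedin X K"
    using cX compactin_imp_closedin by blast
  let ?W = "subtopology X (topspace X - K)"
  have tW: "topspace ?W = topspace X - K"
    by auto
  have oW: "openin X (topspace X - K)"
    using K by blast
  \<comment> \<open>An open subspace of a compact Hausdorff space is locally compact Hausdorff,
    which makes its one-point compactification Hausdorff.\<close>
  have lW: "locally_compact_space ?W" "Hausdorff_space ?W"
    using cX oW by (auto intro: locally_compact_space_open_subset compact_imp_locally_compact_space Hausdorff_space_subtopology)
  let ?A = "Alexandroff_compactification ?W"
  \<comment> \<open>The added point goes to the empty set and the others to singletons, which bounds
    the size by a power set.\<close>
  have "topspace ?A \<lesssim> Pow (topspace X)"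
    unfolding lepoll_def
    by (intro exI[of _ "\<lambda>z. case z of None \<Rightarrow> {} | Some x \<Rightarrow> {x}"]) (auto simp: inj_on_def split: option.splits)
  then obtain T where T: "T \<in> \<U>" "T \<approx> topspace ?A"
    using set_universe_lepoll[OF U XU] by blast
  have "Hausdorff_space ?A"
    using lW by (simp only: Hausdorff_space_Alexandroff_compactification)
  then obtain Z where Z: "Z \<in> Ob (CHaus \<U>)" "Z homeomorphic_space ?A"
    using CHaus_copy[OF U compact_space_Alexandroff_compactification _ T] by blast
  then obtain a b where ab: "homeomorphic_maps ?A Z a b"
    using homeomorphic_space_sym unfolding homeomorphic_space_def by blast
  then have ac: "continuous_map ?A Z a" and ba: "\<And>z. z \<in> topspace ?A \<Longrightarrow> b (a z) = z"
    by (auto simp: homeomorphic_maps_def)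
  define q where "q x = (if x \<in> K then None else Some x)" for x
  have qc: "continuous_map X ?A q"
    unfolding continuous_map_def
  proof (intro conjI allI impI)
    show "q \<in> topspace X \<rightarrow> topspace ?A"
      by (auto simp: q_def)
    fix V assume "openin ?A V"
    \<comment> \<open>Open sets missing the point at infinity pull back to open subsets of
      \<open>topspace X - K\<close>; those containing it pull back to complements of compact, hence
      closed, sets.\<close>
    then consider V' where "openin ?W V'" "V = Some ` V'"
      | C where "compactin ?W C" "V = insert None (Some ` (topspace ?W - C))"
      unfolding openin_Alexandroff_compactification by blast
    then show "openin X {x \<in> topspace X. q x \<in> V}"
    proof cases
      case 1
      then have "openin X V'" "V' \<subseteq> topspace X - K"
        using oW openin_trans_full openin_subset tW by blast+
      moreover have "{x \<in> topspace X. q x \<in> V} = V'"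
        using 1 calculation(2) by (auto simp: q_def split: if_splits)
      ultimately show ?thesis
        by simp
    next
      case 2
      then have "compactin X C" "C \<subseteq> topspace X - K"
        by (auto simp: compactin_subtopology)
      then have "closedin X C"
        using cX compactin_imp_closedin by blast
      moreover have "{x \<in> topspace X. q x \<in> V} = topspace X - C"
        using 2 \<open>C \<subseteq> topspace X - K\<close> by (auto simp: q_def split: if_splits)
      ultimately show ?thesis
        by (simp add: closedin_def)
    qed
  qed
  let ?g = "\<lambda>x\<in>topspace X. a (q x)" and ?h = "\<lambda>x\<in>topspace X. a None"
  have "?g \<in> Arr (CHaus \<U>) X Z"
    using continuous_map_compose[OF qc ac] by (simp add: o_def)
  moreover have "?h \<in> Arr (CHaus \<U>) X Z"
    using continuous_map_app[OF ac, of None] by simp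
  moreover have "Cmp (CHaus \<U>) Y X Z ?g f = Cmp (CHaus \<U>) Y X Z ?h f"
    using fc by (auto simp: compose_eq_iff continuous_map_app q_def K_def)
  ultimately have eq: "?g = ?h"
    using f Z(1) unfolding is_epi_def by blast
  obtain x where x: "x \<in> topspace X" "x \<notin> K"
    using ne Ksub unfolding K_def by blast
  then have "a (Some x) = a None"
    using fun_cong[OF eq, of x] by (simp add: q_def)
  then have "Some x = None"
    using ba[of "Some x"] ba[of None] x by simp
  then show False
    by simp
qed

lemma CHaus_surj_imp_epi:
  assumes "f \<in> Arr (CHaus \<U>) Y X" "f ` topspace Y = topspace X"
  shows "is_epi (CHaus \<U>) Y X f"
  unfolding is_epi_def
proof (intro conjI ballI impI)
  fix Z g h assume gh: "g \<in> Arr (CHaus \<U>) X Z" "h \<in> Arr (CHaus \<U>) X Z"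
    and "Cmp (CHaus \<U>) Y X Z g f = Cmp (CHaus \<U>) Y X Z h f"
  then have "\<forall>y\<in>topspace Y. g (f y) = h (f y)"
    by (simp add: compose_eq_iff)
  then have "\<forall>x\<in>topspace X. g x = h x"
    using assms(2) by (metis imageE)
  then show "g = h"
    using gh by (auto intro: extensionalityI[of _ "topspace X"])
qed (rule assms(1))

text \<open>The usual fibre product inside the product space: it is closed since \<open>X\<close> is
  Hausdorff, hence compact, and is then moved to a copy with points in \<U>.\<close>

lemma CHaus_kernel_pair:
  assumes U: "set_universe \<U>" and X: "X \<in> Ob (CHaus \<U>)" and Y: "Y \<in> Ob (CHaus \<U>)"
    and f: "f \<in> Arr (CHaus \<U>) Y X"
  shows "\<exists>P p q. is_kernel_pair (CHaus \<U>) Y X f P p q"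
proof -
  let ?YY = "prod_topology Y Y"
  define R where "R = {z \<in> topspace ?YY. (f \<circ> fst) z = (f \<circ> snd) z}"
  let ?Z = "subtopology ?YY R"
  have fc: "continuous_map Y X f" and cY: "compact_space Y" "Hausdorff_space Y" and YU: "topspace Y \<in> \<U>"
    using Y f by auto
  have "continuous_map ?YY X (f \<circ> fst)" "continuous_map ?YY X (f \<circ> snd)"
    using fc continuous_map_compose continuous_map_fst continuous_map_snd by blast+
  then have "closedin ?YY R"
    unfolding R_def using X by (intro closedin_continuous_maps_eq[of X]) (simp_all add: o_def)
  moreover have "compact_space ?YY"
    using cY by (simp add: compact_space_prod_topology)
  ultimately have Zc: "compact_space ?Z"
    using closedin_compact_space compact_space_subtopology by blast
  have Zh: "Hausdorff_space ?Z"
    using cY by (simp add: Hausdorff_space_subtopology Hausdorff_space_prod_topology)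
  have tZ: "topspace ?Z = R"
    by (auto simp: R_def)
  obtain T where "T \<in> \<U>" "T \<approx> topspace ?Z"
    using set_universe_Times[OF U YU, of R] unfolding tZ by (auto simp: R_def)
  then obtain P where P: "P \<in> Ob (CHaus \<U>)" "P homeomorphic_space ?Z"
    using CHaus_copy[OF U Zc Zh] by blast
  then obtain a b where "homeomorphic_maps P ?Z a b"
    unfolding homeomorphic_space_def by blast
  then have ac: "continuous_map P ?Z a" and bc: "continuous_map ?Z P b"
    and ba: "\<And>x. x \<in> topspace P \<Longrightarrow> b (a x) = x" and ab: "\<And>z. z \<in> R \<Longrightarrow> a (b z) = z"
    unfolding homeomorphic_maps_def tZ by blast+
  have aR: "a x \<in> R" if "x \<in> topspace P" for x
    using continuous_map_app[OF ac that] tZ by simp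
  have ac': "continuous_map P ?YY a"
    using ac by (simp add: continuous_map_in_subtopology)
  let ?p = "restrict (fst \<circ> a) (topspace P)" and ?q = "restrict (snd \<circ> a) (topspace P)"
  have "is_kernel_pair (CHaus \<U>) Y X f P ?p ?q"
    unfolding is_kernel_pair_def
  proof (intro conjI ballI impI)
    show "P \<in> Ob (CHaus \<U>)"
      by (rule P(1))
    show "?p \<in> Arr (CHaus \<U>) P Y" "?q \<in> Arr (CHaus \<U>) P Y"
      using continuous_map_compose[OF ac' continuous_map_fst] continuous_map_compose[OF ac' continuous_map_snd]
      by simp_all
    show "Cmp (CHaus \<U>) P Y X f ?p = Cmp (CHaus \<U>) P Y X f ?q"
      using aR by (auto simp: compose_eq_iff R_def)
    fix T c d assume T: "T \<in> Ob (CHaus \<U>)" and c: "c \<in> Arr (CHaus \<U>) T Y" and d: "d \<in> Arr (CHaus \<U>) T Y"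
      and "Cmp (CHaus \<U>) T Y X f c = Cmp (CHaus \<U>) T Y X f d"
    then have cdR: "(c t, d t) \<in> R" if "t \<in> topspace T" for t
      using that by (auto simp: compose_eq_iff R_def continuous_map_app)
    \<comment> \<open>The paired map lands in \<open>R\<close> and \<open>b\<close> carries it to
      the copy. Uniqueness holds because \<open>a\<close> recovers both coordinates and
      \<open>b\<close> inverts \<open>a\<close>.\<close>
    let ?u = "\<lambda>t\<in>topspace T. b (c t, d t)"
    have "continuous_map T ?Z (\<lambda>t. (c t, d t))"
      using c d cdR by (simp add: continuous_map_in_subtopology continuous_map_paired)
    then have "continuous_map T P (\<lambda>t. b (c t, d t))"
      using continuous_map_compose[OF _ bc] by (auto simp: o_def)
    then have u: "?u \<in> Arr (CHaus \<U>) T P"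
      by simp
    show "\<exists>!u. u \<in> Arr (CHaus \<U>) T P \<and> Cmp (CHaus \<U>) T P Y ?p u = c \<and> Cmp (CHaus \<U>) T P Y ?q u = d"
    proof (intro ex1I conjI)
      show "?u \<in> Arr (CHaus \<U>) T P"
        by (rule u)
      have uP: "b (c t, d t) \<in> topspace P" if "t \<in> topspace T" for t
        using cdR[OF that] continuous_map_app[OF bc] tZ by blast
      show "Cmp (CHaus \<U>) T P Y ?p ?u = c" "Cmp (CHaus \<U>) T P Y ?q ?u = d"
        using c d by (simp_all add: compose_eq_iff' uP ab cdR)
      fix v assume v: "v \<in> Arr (CHaus \<U>) T P \<and> Cmp (CHaus \<U>) T P Y ?p v = c \<and> Cmp (CHaus \<U>) T P Y ?q v = d"
      show "v = ?u"
      proof (rule extensionalityI[of _ "topspace T"])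
        fix t assume t: "t \<in> topspace T"
        then have vP: "v t \<in> topspace P"
          using v continuous_map_app by auto
        have "a (v t) = (c t, d t)"
          using v c d t vP by (auto simp: compose_eq_iff' intro!: prod_eqI)
        then show "v t = ?u t"
          using ba[OF vP] t by simp
      qed (use v in auto)
    qed
  qed
  then show ?thesis
    by blast
qed

section \<open>The spaces \<open>beta \<U> S\<close> are projective and cover every object\<close>

lemma beta_Ob: "set_universe \<U> \<Longrightarrow> S \<in> \<U> \<Longrightarrow> beta \<U> S \<in> Ob (CHaus \<U>)"
  using beta_copy[of \<U> S] homeomorphic_compact_space homeomorphic_Hausdorff_space
    compact_space_ultrafilter_space Hausdorff_space_ultrafilter_space
  by (metis CHaus_simps(1))

text \<open>Epimorphisms are surjective, so the lifting property of the ultrafilter space applies;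
  \<open>a\<close> and \<open>b\<close> transport it along the homeomorphism with the chosen
  copy.\<close>

lemma beta_projective:
  assumes U: "set_universe \<U>" and S: "S \<in> \<U>" and X: "X \<in> Ob (CHaus \<U>)" and Y: "Y \<in> Ob (CHaus \<U>)"
    and f: "is_epi (CHaus \<U>) Y X f" and g: "g \<in> Arr (CHaus \<U>) (beta \<U> S) X"
  shows "\<exists>h\<in>Arr (CHaus \<U>) (beta \<U> S) Y. Cmp (CHaus \<U>) (beta \<U> S) Y X f h = g"
proof -
  obtain a b where ab: "homeomorphic_maps (beta \<U> S) (ultrafilter_space S) a b"
    using beta_copy[OF U S] unfolding homeomorphic_space_def by blast
  then have ac: "continuous_map (beta \<U> S) (ultrafilter_space S) a"
    and bc: "continuous_map (ultrafilter_space S) (beta \<U> S) b"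
    and ba: "\<And>x. x \<in> topspace (beta \<U> S) \<Longrightarrow> b (a x) = x"
    by (auto simp: homeomorphic_maps_def)
  have fc: "continuous_map Y X f" "f ` topspace Y = topspace X"
    using f CHaus_epi_imp_surj[OF U X Y f] by (simp_all add: is_epi_def)
  have "continuous_map (ultrafilter_space S) X (g \<circ> b)"
    using g bc by (auto intro: continuous_map_compose)
  then obtain h where h: "continuous_map (ultrafilter_space S) Y h" "\<And>F. F \<in> ultrafilters_on S \<Longrightarrow> f (h F) = (g \<circ> b) F"
    using ultrafilter_space_projective[OF _ _ _ fc] X Y by (metis CHaus_simps(1))
  have "restrict (h \<circ> a) (topspace (beta \<U> S)) \<in> Arr (CHaus \<U>) (beta \<U> S) Y"
    using continuous_map_compose[OF ac h(1)] by simp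
  moreover have "Cmp (CHaus \<U>) (beta \<U> S) Y X f (restrict (h \<circ> a) (topspace (beta \<U> S))) = g"
    using g h(2) ba continuous_map_app[OF ac] by (simp add: compose_eq_iff' topspace_ultrafilter_space)
  ultimately show ?thesis
    by blast
qed

text \<open>Extend the identity of the discrete set of points: each ultrafilter goes to its limit,
  and the principal ultrafilter at a point goes to that point, so the map is onto.\<close>

lemma beta_cover:
  assumes U: "set_universe \<U>" and X: "X \<in> Ob (CHaus \<U>)"
  shows "\<exists>p. is_epi (CHaus \<U>) (beta \<U> (topspace X)) X p"
proof -
  let ?S = "topspace X"
  have S: "?S \<in> \<U>" and cX: "compact_space X" "Hausdorff_space X"
    using X by auto
  obtain a b where ab: "homeomorphic_maps (beta \<U> ?S) (ultrafilter_space ?S) a b"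
    using beta_copy[OF U S] unfolding homeomorphic_space_def by blast
  then have ac: "continuous_map (beta \<U> ?S) (ultrafilter_space ?S) a"
    and bc: "continuous_map (ultrafilter_space ?S) (beta \<U> ?S) b"
    and ab: "\<And>x. x \<in> ultrafilters_on ?S \<Longrightarrow> a (b x) = x"
    by (auto simp: homeomorphic_maps_def topspace_ultrafilter_space)
  obtain g where g: "continuous_map (ultrafilter_space ?S) X g" "\<And>x. x \<in> ?S \<Longrightarrow> g (principal ?S x) = x"
    using ultrafilter_space_extension[OF cX, of "\<lambda>x. x" ?S] by auto
  let ?p = "restrict (g \<circ> a) (topspace (beta \<U> ?S))"
  have p: "?p \<in> Arr (CHaus \<U>) (beta \<U> ?S) X"
    using continuous_map_compose[OF ac g(1)] by simp
  moreover have "?p ` topspace (beta \<U> ?S) = topspace X"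
  proof
    show "?p ` topspace (beta \<U> ?S) \<subseteq> topspace X"
      using p continuous_map_app by fastforce
    show "topspace X \<subseteq> ?p ` topspace (beta \<U> ?S)"
    proof
      fix x assume x: "x \<in> topspace X"
      let ?F = "principal ?S x"
      have "b ?F \<in> topspace (beta \<U> ?S)"
        using continuous_map_app[OF bc] principal_ultrafilter[OF x] by (simp add: topspace_ultrafilter_space)
      then show "x \<in> ?p ` topspace (beta \<U> ?S)"
        using g(2)[OF x] ab[OF principal_ultrafilter[OF x]] by (intro image_eqI[of _ _ "b ?F"]) simp_all
    qed
  qed
  ultimately show ?thesis
    using CHaus_surj_imp_epi by blast
qed

theorem theorem3p3:
  fixes \<U> :: "'u set set"
  assumes "set_universe \<U>"
  shows "is_functor (CHaus_hat \<U>) (beta_Sets_hat \<U>) (Res \<U>) \<and>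
         is_equivalence (CHaus_hat_star \<U>) (beta_Sets_hat \<U>) (Res \<U>)"
proof -
  \<comment> \<open>Topology enters through these assumptions: projectivity and covers come from
    ultrafilters, kernel pairs from closed subspaces of squares.\<close>
  interpret projective_covers "CHaus \<U>" "beta \<U> ` \<U>" \<U>
  proof
    show "is_category (CHaus \<U>)"
      by (rule is_category_CHaus)
    show "beta \<U> ` \<U> \<subseteq> Ob (CHaus \<U>)"
      using beta_Ob[OF assms] by blast
    show "\<exists>h\<in>Arr (CHaus \<U>) A Y. Cmp (CHaus \<U>) A Y X f h = g"
      if "A \<in> beta \<U> ` \<U>" "X \<in> Ob (CHaus \<U>)" "Y \<in> Ob (CHaus \<U>)" "is_epi (CHaus \<U>) Y X f"
        "g \<in> Arr (CHaus \<U>) A X" for A X Y f g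
      using that beta_projective[OF assms] by blast
    show "\<exists>A\<in>beta \<U> ` \<U>. \<exists>p. is_epi (CHaus \<U>) A X p" if "X \<in> Ob (CHaus \<U>)" for X
      using beta_cover[OF assms that] that by auto
    show "\<exists>P p q. is_kernel_pair (CHaus \<U>) Y X f P p q"
      if "X \<in> Ob (CHaus \<U>)" "Y \<in> Ob (CHaus \<U>)" "is_epi (CHaus \<U>) Y X f" for X Y f
      using that CHaus_kernel_pair[OF assms] unfolding is_epi_def by blast
    show "\<exists>T\<in>\<U>. T \<approx> A" if "S \<in> \<U>" "A \<subseteq> S" for S A
      using set_universe_subset[OF assms that] .
  qed
  \<comment> \<open>The concrete notions unfold literally to those of the locale.\<close>
  have "CHaus_hat \<U> = hatC" "beta_Sets_hat \<U> = hatB"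
    by (simp_all only: CHaus_hat_def beta_Sets_hat_def beta_Sets_def)
  moreover have "CHaus_hat_star \<U> = full_subcat hatC sheaves"
    by (simp only: CHaus_hat_star_def CHaus_hat_def sheaves_def)
  moreover have "Res \<U> = res"
    by (simp only: Res_def res_def beta_Sets_def)
  ultimately show ?thesis
    using is_functor_res res_is_equivalence by simp
qed

end
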